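(* Let $d\ge 1$, let $\psi$ be a nonzero entire function on $\mathbb C^d$ and let $\varphi$ be a holomorphic self-mapping of $\mathbb C^d$. (a) The maximal weighted composition operator $C_{\psi,\varphi,\max}$ on $\mathcal F^2(\mathbb C^d)$ is real symmetric (i.e. $C_{\psi,\varphi,\max}=C_{\psi,\varphi,\max}^*$) if and only if there exist a $d\times d$ matrix $Q$ with $Q=Q^*$, a vector $q\in\mathbb C^d$ and $\theta\in\mathbb R$ such that $$\psi(z)=\theta e^{\langle z,q\rangle},\qquad \varphi(z)=Qz+q\qquad(z\in\mathbb C^d).$$ Likewise, $C_{\psi,\varphi,\max}$ is skew-real symmetric (i.e. $C_{\psi,\varphi,\max}=-C_{\psi,\varphi,\max}^*$) if and only if $\psi,\varphi$ have the same forms with $Q=Q^*$, $q\in\mathbb C^d$ and $\theta\in i\mathbb R$. (b) Let $C_{\psi,\varphi}$ be a weighted composition operator on $\mathcal F^2(\mathbb C^d)$ (i.e. $C_{\psi,\varphi}\preceq C_{\psi,\varphi,\max}$). Then $C_{\psi,\varphi}$ is real symmetric (respectively skew-real symmetric) if and only if $C_{\psi,\varphi}=C_{\psi,\varphi,\max}$ and $\psi(z)=\theta e^{\langle z,q\rangle}$, $\varphi(z)=Qz+q$ with $Q=Q^*$, $q\in\mathbb C^d$ and $\theta\in\mathbb R$ (respectively $\theta\in i\mathbb R$).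
   Context: For $u,z\in\mathbb C^d$, $\langle u,z\rangle=\sum_{j=1}^d u_j\overline{z_j}$ and $|z|^2=\langle z,z\rangle$. The Fock space $\mathcal F^2(\mathbb C^d)$ is the Hilbert space of entire functions $f$ on $\mathbb C^d$ with $\|f\|^2=\pi^{-d}\int_{\mathbb C^d}|f(z)|^2e^{-|z|^2}\,dV(z)<\infty$ ($dV$ Lebesgue measure), with the corresponding inner product; its reproducing kernels are $K_z(u)=e^{\langle u,z\rangle}$. For a matrix $M$, $M^{\mathbf t}$ is the transpose, $\overline M$ the entrywise conjugate, and $M^*=\overline M^{\mathbf t}$. For (possibly unbounded) operators, $T\preceq S$ means $\mathrm{dom}(T)\subseteq\mathrm{dom}(S)$ and $Tf=Sf$ on $\mathrm{dom}(T)$; $T^*$ is the Hilbert space adjoint. Given $\psi,\varphi$, set $E_{\psi,\varphi}(f)=\psi\cdot (f\circ\varphi)$. The maximal weighted composition operator $C_{\psi,\varphi,\max}$ has domain $\{f\in\mathcal F^2(\mathbb C^d):E_{\psi,\varphi}(f)\in\mathcal F^2(\mathbb C^d)\}$ and acts by $C_{\psi,\varphi,\max}f=E_{\psi,\varphi}(f)$. A weighted composition operator is any operator $C_{\psi,\varphi}$ with $C_{\psi,\varphi}\preceq C_{\psi,\varphi,\max}$. *)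

theory Defs
  imports "HOL-Analysis.Analysis"
begin

text \<open>Points of C^d are vectors of type complex^'n, where d = CARD('n) >= 1.\<close>

definition cinner :: "complex^'n \<Rightarrow> complex^'n \<Rightarrow> complex" where
  "cinner u z = (\<Sum>j\<in>UNIV. u $ j * cnj (z $ j))"

definition cmat_adj :: "complex^'n^'n \<Rightarrow> complex^'n^'n" where
  "cmat_adj M = (\<chi> i j. cnj (M $ j $ i))"

definition entire_fun :: "(complex^'n \<Rightarrow> complex) \<Rightarrow> bool" where
  "entire_fun f \<longleftrightarrow> (\<forall>z. \<exists>L. (f has_derivative L) (at z) \<and>
       (\<forall>c x. L (\<chi> i. c * x $ i) = c * L x))"

definition holo_self_map :: "(complex^'n \<Rightarrow> complex^'n) \<Rightarrow> bool" where
  "holo_self_map \<phi> \<longleftrightarrow> (\<forall>i. entire_fun (\<lambda>z. \<phi> z $ i))"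

definition fock :: "(complex^'n \<Rightarrow> complex) set" where
  "fock = {f. entire_fun f \<and>
      integrable lborel (\<lambda>z. (cmod (f z))\<^sup>2 * exp (- (norm z)\<^sup>2))}"

definition fock_inner :: "(complex^'n \<Rightarrow> complex) \<Rightarrow> (complex^'n \<Rightarrow> complex) \<Rightarrow> complex" where
  "fock_inner f g = complex_of_real (1 / pi ^ CARD('n)) *
      integral\<^sup>L lborel (\<lambda>z. f z * cnj (g z) * complex_of_real (exp (- (norm z)\<^sup>2)))"

text \<open>A (possibly unbounded) operator is given by its domain D and its action T on D.\<close>
definition op_graph :: "(complex^'n \<Rightarrow> complex) set \<Rightarrow>
    ((complex^'n \<Rightarrow> complex) \<Rightarrow> (complex^'n \<Rightarrow> complex)) \<Rightarrow>
    ((complex^'n \<Rightarrow> complex) \<times> (complex^'n \<Rightarrow> complex)) set" where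
  "op_graph D T = {(f, T f) | f. f \<in> D}"

text \<open>Graph of the Hilbert space adjoint (a genuine operator graph iff D is dense).\<close>
definition adj_graph :: "(complex^'n \<Rightarrow> complex) set \<Rightarrow>
    ((complex^'n \<Rightarrow> complex) \<Rightarrow> (complex^'n \<Rightarrow> complex)) \<Rightarrow>
    ((complex^'n \<Rightarrow> complex) \<times> (complex^'n \<Rightarrow> complex)) set" where
  "adj_graph D T = {(g, h). g \<in> fock \<and> h \<in> fock \<and>
      (\<forall>f\<in>D. fock_inner (T f) g = fock_inner f h)}"

definition real_symmetric_op where
  "real_symmetric_op D T \<longleftrightarrow> op_graph D T = adj_graph D T"

definition skew_real_symmetric_op where
  "skew_real_symmetric_op D T \<longleftrightarrow> op_graph D T = {(g, - h) | g h. (g, h) \<in> adj_graph D T}"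

definition E_op :: "(complex^'n \<Rightarrow> complex) \<Rightarrow> (complex^'n \<Rightarrow> complex^'n) \<Rightarrow>
    (complex^'n \<Rightarrow> complex) \<Rightarrow> (complex^'n \<Rightarrow> complex)" where
  "E_op \<psi> \<phi> f = (\<lambda>z. \<psi> z * f (\<phi> z))"

definition dom_max :: "(complex^'n \<Rightarrow> complex) \<Rightarrow> (complex^'n \<Rightarrow> complex^'n) \<Rightarrow>
    (complex^'n \<Rightarrow> complex) set" where
  "dom_max \<psi> \<phi> = {f \<in> fock. E_op \<psi> \<phi> f \<in> fock}"

end

theory Submission
  imports Defs "HOL-Probability.Distributions" "HOL-Complex_Analysis.Complex_Analysis"
begin

text \<open>Write \<open>T\<close> for the operator and \<open>K\<^sub>z\<close> for the reproducing kernels. Since \<open>T\<^sup>* K\<^sub>z\<close> is the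
  conjugate of \<open>\<psi>(z)\<close> times \<open>K\<^bsub>\<phi>(z)\<^esub>\<close>, symmetry gives a functional equation for \<open>\<psi>\<close> and \<open>\<phi>\<close>;
  setting one variable to \<open>0\<close> yields \<open>\<psi>\<close>, and comparing exponents (up to a continuous function with
  values in \<open>2\<pi>i\<int>\<close>) shows that \<open>\<phi> - \<phi>(0)\<close> is a Hermitian map. Conversely, for \<open>\<phi>(z) = Qz + q\<close>
  testing against kernels shows \<open>T\<^sup>* \<subseteq> T\<close>. The point is the symmetry of \<open>T\<close> on its maximal domain.
  Replace \<open>Q\<close> by \<open>rQ\<close>: for small \<open>r > 0\<close> the reproducing formula and Fubini give
  \<open>\<langle>T\<^sub>r f, g\<rangle> = \<langle>f, T\<^sub>r g\<rangle>\<close>. If \<open>Tf\<close> is in the Fock space, then \<open>T\<^sub>r f(z) = e\<^bsup>(1-r)\<langle>z,q\<rangle>\<^esup> (Tf)(rz)\<close>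
  depends holomorphically on \<open>r\<close> in the unit disc and is bounded in norm as \<open>r\<close> tends to \<open>1\<close>, so the
  identity theorem and a weak limit give \<open>\<langle>Tf, g\<rangle> = \<langle>f, Tg\<rangle>\<close>. Multiplying \<open>\<psi>\<close> by \<open>i\<close> turns the
  skew case into the real one.\<close>

section \<open>Lebesgue integrals on Euclidean space\<close>

lemma nn_integral_exp_neg_square:
  "(\<integral>\<^sup>+x. ennreal (exp (- x\<^sup>2)) \<partial>lborel) = ennreal (sqrt pi)"
proof -
  have "has_bochner_integral lborel (\<lambda>x::real. exp (- x\<^sup>2)) (2 * (sqrt pi / 2))"
    using has_bochner_integral_even_function[OF gaussian_moment_0] by simp
  then show ?thesis
    by (auto simp: has_bochner_integral_iff nn_integral_eq_integral)
qed

lemma nn_integral_gauss: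
  "(\<integral>\<^sup>+x. ennreal (exp (- (norm (x::'a::euclidean_space))\<^sup>2)) \<partial>lborel) = ennreal (sqrt pi ^ DIM('a))"
proof -
  have "exp (- (norm x)\<^sup>2) = (\<Prod>b\<in>Basis. exp (- (x \<bullet> b)\<^sup>2))" for x :: 'a
    by (subst power2_norm_eq_inner, subst euclidean_inner)
       (simp add: exp_sum[symmetric] sum_negf power2_eq_square)
  then have "(\<integral>\<^sup>+x. ennreal (exp (- (norm (x::'a))\<^sup>2)) \<partial>lborel)
      = (\<integral>\<^sup>+x. (\<Prod>b\<in>Basis. ennreal (exp (- ((x::'a) \<bullet> b)\<^sup>2))) \<partial>lborel)"
    by (simp add: prod_ennreal)
  also have "\<dots> = (\<Prod>b\<in>(Basis::'a set). (\<integral>\<^sup>+x. ennreal (exp (- x\<^sup>2)) \<partial>lborel))"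
    by (rule nn_integral_lborel_prod) auto
  finally show ?thesis
    by (simp add: nn_integral_exp_neg_square ennreal_power)
qed

lemma nn_integral_lborel_shift:
  fixes c :: "'a::euclidean_space"
  assumes [measurable]: "f \<in> borel_measurable borel"
  shows "(\<integral>\<^sup>+x. f (c + x) \<partial>lborel) = (\<integral>\<^sup>+x. f x \<partial>lborel)"
  by (subst (2) lborel_distr_plus[of c, symmetric]) (simp add: nn_integral_distr)

lemma nn_integral_lborel_scale:
  assumes [measurable]: "f \<in> borel_measurable borel" and "c \<noteq> 0"
  shows "(\<integral>\<^sup>+x. f (x::'a::euclidean_space) \<partial>lborel) = ennreal (\<bar>c\<bar> ^ DIM('a)) * (\<integral>\<^sup>+x. f (c *\<^sub>R x) \<partial>lborel)"
  by (subst lborel_affine[OF assms(2), of 0])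
     (simp add: nn_integral_density nn_integral_distr nn_integral_cmult ennreal_power)

text \<open>Uniqueness of Haar measure by Fubini, with the Gaussian as a radial test function:
  both sides are compared after multiplication by its integral.\<close>
lemma nn_integral_lborel_isometry:
  fixes R S :: "'a::euclidean_space \<Rightarrow> 'a"
  assumes f[measurable]: "f \<in> borel_measurable borel"
    and R: "linear R" "\<And>x. norm (R x) = norm x" and S: "\<And>x. R (S x) = x"
  shows "(\<integral>\<^sup>+x. f (R x) \<partial>lborel) = (\<integral>\<^sup>+x. f x \<partial>lborel)"
proof -
  define g where "g x = ennreal (exp (- (norm (x::'a))\<^sup>2))" for x
  have [measurable]: "g \<in> borel_measurable borel" unfolding g_def by measurable
  have [measurable]: "R \<in> borel_measurable borel"
    by (intro borel_measurable_continuous_onI linear_continuous_on) (simp add: R linear_conv_bounded_linear[symmetric])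
  define G where "G = (\<integral>\<^sup>+y. g y \<partial>lborel)"
  have G: "G = ennreal (sqrt pi ^ DIM('a))" unfolding G_def g_def by (rule nn_integral_gauss)
  have "(\<integral>\<^sup>+x. f (R x) \<partial>lborel) * G = (\<integral>\<^sup>+x. f (R x) * G \<partial>lborel)"
    by (simp add: nn_integral_multc)
  also have "\<dots> = (\<integral>\<^sup>+x. f (R x) * (\<integral>\<^sup>+y. g (- R x + y) \<partial>lborel) \<partial>lborel)"
    by (subst nn_integral_lborel_shift) (simp_all add: G_def)
  also have "\<dots> = (\<integral>\<^sup>+x. (\<integral>\<^sup>+y. f (R x) * g (- R x + y) \<partial>lborel) \<partial>lborel)"
    by (simp add: nn_integral_cmult)
  also have "\<dots> = (\<integral>\<^sup>+y. (\<integral>\<^sup>+x. f (R x) * g (- R x + y) \<partial>lborel) \<partial>lborel)"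
    by (rule lborel_pair.Fubini') measurable
  \<comment> \<open>The shift by \<open>S y\<close> turns \<open>R x\<close> into
    \<open>R x + y\<close>. The argument of \<open>g\<close> becomes \<open>- R x\<close>, and since
    \<open>g\<close> is radial and \<open>R\<close> preserves norms, \<open>g x\<close> may stand
    there instead.\<close>
  also have "\<dots> = (\<integral>\<^sup>+y. (\<integral>\<^sup>+x. f (R (S y + x)) * g (- R (S y + x) + y) \<partial>lborel) \<partial>lborel)"
    by (intro nn_integral_cong nn_integral_lborel_shift[symmetric]) measurable
  also have "\<dots> = (\<integral>\<^sup>+y. (\<integral>\<^sup>+x. f (R x + y) * g x \<partial>lborel) \<partial>lborel)"
    by (simp add: linear_add[OF R(1)] S g_def R(2) add.commute)
  also have "\<dots> = (\<integral>\<^sup>+x. (\<integral>\<^sup>+y. f (R x + y) * g x \<partial>lborel) \<partial>lborel)"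
    by (rule lborel_pair.Fubini') measurable
  also have "\<dots> = (\<integral>\<^sup>+x. f x \<partial>lborel) * G"
    by (simp add: nn_integral_multc nn_integral_lborel_shift nn_integral_cmult G_def)
  finally have "(\<integral>\<^sup>+x. f (R x) \<partial>lborel) * G / G = (\<integral>\<^sup>+x. f x \<partial>lborel) * G / G"
    by simp
  moreover have "G \<noteq> 0" "G \<noteq> top" by (auto simp: G ennreal_eq_0_iff not_le)
  ultimately show ?thesis
    by (simp add: mult_divide_eq_ennreal)
qed

lemma lborel_distr_isometry:
  fixes R S :: "'a::euclidean_space \<Rightarrow> 'a"
  assumes R: "linear R" "\<And>x. norm (R x) = norm x" and S: "\<And>x. R (S x) = x"
  shows "distr lborel borel R = lborel"
proof (rule measure_eqI)
  have R': "R \<in> borel_measurable borel"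
    by (intro borel_measurable_continuous_onI linear_continuous_on) (simp add: R linear_conv_bounded_linear[symmetric])
  fix A assume "A \<in> sets (distr lborel borel R)"
  then have A[measurable]: "A \<in> sets borel" by simp
  have "emeasure (distr lborel borel R) A = (\<integral>\<^sup>+x. indicator A x \<partial>distr lborel borel R)"
    by simp
  also have "\<dots> = (\<integral>\<^sup>+x. indicator A (R x) \<partial>lborel)"
    using R' by (intro nn_integral_distr) auto
  also have "\<dots> = emeasure lborel A"
    using nn_integral_lborel_isometry[OF _ assms, of "indicator A"] by simp
  finally show "emeasure (distr lborel borel R) A = emeasure lborel A" .
qed simp

text \<open>Completing the square absorbs \<open>a * norm x\<close> at the price of half the
  quadratic term. What remains is a rescaled Gaussian, integrable by the explicit Gaussian integral
  and the scaling rule.\<close>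

lemma integrable_exp_norm:
  assumes "c > 0"
  shows "integrable lborel (\<lambda>x::'a::euclidean_space. exp (a * norm x - c * (norm x)\<^sup>2))"
proof (rule Bochner_Integration.integrable_bound)
  \<comment> \<open>With this \<open>s\<close>, scaling the argument by \<open>s\<close> carries the
    standard Gaussian to \<open>exp (- (c / 2 * (norm x)\<^sup>2))\<close>.\<close>
  define s where "s = sqrt (c / 2)"
  have s: "s \<noteq> 0" "s\<^sup>2 = c / 2" using assms by (auto simp: s_def)
  have "ennreal (sqrt pi ^ DIM('a)) =
      ennreal (\<bar>s\<bar> ^ DIM('a)) * (\<integral>\<^sup>+x. ennreal (exp (- (norm (s *\<^sub>R (x::'a)))\<^sup>2)) \<partial>lborel)"
    using nn_integral_lborel_scale[of "\<lambda>x::'a. ennreal (exp (- (norm x)\<^sup>2))" s] s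
    by (simp add: nn_integral_gauss)
  then have *: "ennreal (sqrt pi ^ DIM('a)) =
      ennreal (\<bar>s\<bar> ^ DIM('a)) * (\<integral>\<^sup>+x. ennreal (exp (- (c / 2 * (norm (x::'a))\<^sup>2))) \<partial>lborel)"
    by (simp add: power_mult_distrib s)
  have "(\<integral>\<^sup>+x. ennreal (exp (- (c / 2 * (norm (x::'a))\<^sup>2))) \<partial>lborel) < \<infinity>"
  proof (rule ccontr)
    assume "\<not> ?thesis"
    then have "(\<integral>\<^sup>+x. ennreal (exp (- (c / 2 * (norm (x::'a))\<^sup>2))) \<partial>lborel) = \<infinity>"
      by (simp add: less_top[symmetric])
    with * have "ennreal (sqrt pi ^ DIM('a)) = ennreal (\<bar>s\<bar> ^ DIM('a)) * top" by simp
    moreover have "ennreal (\<bar>s\<bar> ^ DIM('a)) \<noteq> 0"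
      using s zero_less_power[of "\<bar>s\<bar>" "DIM('a)"] by (metis ennreal_eq_0_iff not_le zero_less_abs_iff)
    ultimately show False by (simp add: ennreal_mult_eq_top_iff ennreal_mult_top)
  qed
  then have "integrable lborel (\<lambda>x::'a. exp (- (c / 2 * (norm x)\<^sup>2)))"
    by (intro integrableI_bounded) auto
  then show "integrable lborel (\<lambda>x::'a. exp (a\<^sup>2 / (2 * c)) * exp (- (c / 2 * (norm x)\<^sup>2)))"
    by simp
  have "a * t - c * t\<^sup>2 \<le> a\<^sup>2 / (2 * c) - c / 2 * t\<^sup>2" for t
  proof -
    have "0 \<le> (a - c * t)\<^sup>2 / (2 * c)" using assms by simp
    also have "\<dots> = a\<^sup>2 / (2 * c) - c / 2 * t\<^sup>2 - (a * t - c * t\<^sup>2)"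
      using assms by (simp add: field_simps power2_eq_square)
    finally show ?thesis by simp
  qed
  then show "AE x in lborel. norm (exp (a * norm x - c * (norm x)\<^sup>2))
      \<le> norm (exp (a\<^sup>2 / (2 * c)) * exp (- (c / 2 * (norm (x::'a))\<^sup>2)))"
    by (intro AE_I2) (simp add: exp_add[symmetric])
qed measurable

section \<open>Products of square integrable functions and weak limits\<close>

text \<open>Expanding a square even gives the bound for \<open>2 * (a * b)\<close>. Applied
  pointwise under an integral it takes the place of the Cauchy-Schwarz inequality; the weight
  \<open>e\<close> is free and can be tuned to make one of the two terms small.\<close>

lemma weighted_am_gm:
  fixes a b e :: real
  assumes "0 \<le> a" "0 \<le> b" "0 < e"
  shows "a * b \<le> e * a\<^sup>2 + b\<^sup>2 / e"
proof -
  have "0 \<le> (e * a - b)\<^sup>2 / e" using assms by simp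
  also have "\<dots> = e * a\<^sup>2 + b\<^sup>2 / e - 2 * (a * b)"
    using assms by (simp add: field_simps power2_eq_square)
  finally show ?thesis using mult_nonneg_nonneg[OF assms(1,2)] by simp
qed

text \<open>Pointwise convergence and boundedness in \<open>L\<^sup>2\<close> give weak convergence.
  On each \<open>A k\<close> dominated convergence applies; cutting \<open>w\<close> off outside
  \<open>A k\<close> changes the integrals by an amount that is small uniformly in \<open>n\<close>,
  because the tails of \<open>w\<close> tend to 0 in \<open>L\<^sup>2\<close> and the
  \<open>v n\<close> are bounded there.\<close>

lemma tendsto_integral_weak_L2:
  fixes v :: "nat \<Rightarrow> 'a \<Rightarrow> complex" and w v0 :: "'a \<Rightarrow> complex"
  assumes [measurable]: "\<And>n. v n \<in> borel_measurable M" "v0 \<in> borel_measurable M" "w \<in> borel_measurable M"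
    and lim: "\<And>x. (\<lambda>n. v n x) \<longlonglongrightarrow> v0 x"
    and w2: "integrable M (\<lambda>x. (cmod (w x))\<^sup>2)"
    and v2: "\<And>n. integrable M (\<lambda>x. (cmod (v n x))\<^sup>2)" "\<And>n. (\<integral>x. (cmod (v n x))\<^sup>2 \<partial>M) \<le> B"
    and v02: "integrable M (\<lambda>x. (cmod (v0 x))\<^sup>2)" "(\<integral>x. (cmod (v0 x))\<^sup>2 \<partial>M) \<le> B"
    and A: "\<And>k::nat. A k \<in> sets M" "\<And>x. \<forall>\<^sub>F k in sequentially. x \<in> A k"
    and bd: "\<And>k. \<exists>h. integrable M h \<and> (\<forall>n. \<forall>x\<in>A k. cmod (v n x * w x) \<le> h x)"
  shows "(\<lambda>n. \<integral>x. v n x * w x \<partial>M) \<longlonglongrightarrow> (\<integral>x. v0 x * w x \<partial>M)"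
proof -
  have prod_int: "integrable M (\<lambda>x. f x * g x)"
    if [measurable]: "f \<in> borel_measurable M" "g \<in> borel_measurable M"
    and "integrable M (\<lambda>x. (cmod (f x))\<^sup>2)" "integrable M (\<lambda>x. (cmod (g x))\<^sup>2)" for f g :: "'a \<Rightarrow> complex"
  proof (rule Bochner_Integration.integrable_bound)
    show "integrable M (\<lambda>x. (cmod (f x))\<^sup>2 + (cmod (g x))\<^sup>2)" using that by simp
    show "AE x in M. norm (f x * g x) \<le> norm ((cmod (f x))\<^sup>2 + (cmod (g x))\<^sup>2)"
      using weighted_am_gm[of _ _ 1] by (intro AE_I2) (simp add: norm_mult)
  qed measurable
  have [measurable]: "A k \<in> sets M" for k by (rule A)
  define W where "W k x = indicator (A k) x *\<^sub>R w x" for k x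
  have [measurable]: "W k \<in> borel_measurable M" for k unfolding W_def by measurable
  have W2: "integrable M (\<lambda>x. (cmod (W k x))\<^sup>2)" for k
    by (rule Bochner_Integration.integrable_bound[OF w2]) (auto simp: W_def indicator_def)
  have WW2: "integrable M (\<lambda>x. (cmod (w x - W k x))\<^sup>2)" for k
    by (rule Bochner_Integration.integrable_bound[OF w2]) (auto simp: W_def indicator_def)
  have tail: "(\<lambda>k. \<integral>x. (cmod (w x - W k x))\<^sup>2 \<partial>M) \<longlonglongrightarrow> (\<integral>x. 0 \<partial>M)"
  proof (rule integral_dominated_convergence[OF _ _ w2])
    show "AE x in M. (\<lambda>k. (cmod (w x - W k x))\<^sup>2) \<longlonglongrightarrow> 0"
    proof (rule AE_I2)
      fix x
      have "\<forall>\<^sub>F k in sequentially. (cmod (w x - W k x))\<^sup>2 = 0"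
        using A(2)[of x] by eventually_elim (simp add: W_def)
      then show "(\<lambda>k. (cmod (w x - W k x))\<^sup>2) \<longlonglongrightarrow> 0" by (rule tendsto_eventually)
    qed
    show "AE x in M. norm ((cmod (w x - W k x))\<^sup>2) \<le> (cmod (w x))\<^sup>2" for k
      by (rule AE_I2) (auto simp: W_def indicator_def)
  qed measurable
  have trunc: "(\<lambda>n. \<integral>x. v n x * W k x \<partial>M) \<longlonglongrightarrow> (\<integral>x. v0 x * W k x \<partial>M)" for k
  proof -
    obtain h where h: "integrable M h" "\<And>n x. x \<in> A k \<Longrightarrow> cmod (v n x * w x) \<le> h x"
      using bd[of k] by blast
    show ?thesis
    proof (rule integral_dominated_convergence)
      show "integrable M (\<lambda>x. norm (h x))" using h by simp
      show "AE x in M. (\<lambda>n. v n x * W k x) \<longlonglongrightarrow> v0 x * W k x"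
        by (intro AE_I2 tendsto_mult lim tendsto_const)
      show "AE x in M. norm (v n x * W k x) \<le> norm (h x)" for n
        using h(2)[of _ n] by (intro AE_I2) (auto simp: W_def indicator_def intro: order_trans[OF _ abs_ge_self])
    qed measurable
  qed
  have close: "cmod ((\<integral>x. f x * w x \<partial>M) - (\<integral>x. f x * W k x \<partial>M))
      \<le> e * B + (\<integral>x. (cmod (w x - W k x))\<^sup>2 \<partial>M) / e"
    if [measurable]: "f \<in> borel_measurable M" and f: "integrable M (\<lambda>x. (cmod (f x))\<^sup>2)"
      "(\<integral>x. (cmod (f x))\<^sup>2 \<partial>M) \<le> B" and e: "e > 0" for f k e
  proof -
    have "(\<integral>x. f x * w x \<partial>M) - (\<integral>x. f x * W k x \<partial>M) = (\<integral>x. f x * (w x - W k x) \<partial>M)"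
      using prod_int[OF _ _ f(1) w2] prod_int[OF _ _ f(1) W2[of k]]
      by (simp add: right_diff_distrib)
    also have "cmod \<dots> \<le> (\<integral>x. e * (cmod (f x))\<^sup>2 + (cmod (w x - W k x))\<^sup>2 / e \<partial>M)"
    proof (rule order_trans[OF integral_norm_bound], rule integral_mono)
      show "integrable M (\<lambda>x. norm (f x * (w x - W k x)))"
        by (rule integrable_norm, rule prod_int[OF _ _ f(1) WW2]) measurable
      show "integrable M (\<lambda>x. e * (cmod (f x))\<^sup>2 + (cmod (w x - W k x))\<^sup>2 / e)"
        using f WW2[of k] by simp
      show "norm (f x * (w x - W k x)) \<le> e * (cmod (f x))\<^sup>2 + (cmod (w x - W k x))\<^sup>2 / e" for x
        using e by (simp add: norm_mult weighted_am_gm)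
    qed
    also have "\<dots> = e * (\<integral>x. (cmod (f x))\<^sup>2 \<partial>M) + (\<integral>x. (cmod (w x - W k x))\<^sup>2 \<partial>M) / e"
      using f WW2[of k] by simp
    also have "\<dots> \<le> e * B + (\<integral>x. (cmod (w x - W k x))\<^sup>2 \<partial>M) / e"
      using f e by simp
    finally show ?thesis .
  qed
  have "0 \<le> (\<integral>x. (cmod (v0 x))\<^sup>2 \<partial>M)" by (rule integral_nonneg_AE) simp
  then have B: "0 \<le> B" using v02 by linarith
  show ?thesis
  proof (rule LIMSEQ_I)
    fix eps :: real assume eps: "eps > 0"
    \<comment> \<open>This makes \<open>e * B\<close> at most \<open>eps / 6\<close>. Then
      \<open>k\<close> is chosen so that the tail divided by \<open>e\<close> is below
      \<open>eps / 6\<close> too, and each of the two truncation errors is below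
      \<open>eps / 3\<close>. The summand 1 covers \<open>B = 0\<close>.\<close>
    define e where "e = eps / (6 * (B + 1))"
    have e: "e > 0" "e * B \<le> eps / 6"
      using eps B by (auto simp: e_def field_simps)
    have "\<forall>\<^sub>F k in sequentially. (\<integral>x. (cmod (w x - W k x))\<^sup>2 \<partial>M) < e * (eps / 6)"
      using order_tendstoD(2)[OF tail, of "e * (eps / 6)"] e eps by simp
    then obtain k where k: "(\<integral>x. (cmod (w x - W k x))\<^sup>2 \<partial>M) < e * (eps / 6)"
      by (auto simp: eventually_sequentially)
    then have k': "(\<integral>x. (cmod (w x - W k x))\<^sup>2 \<partial>M) / e < eps / 6"
      using e by (simp add: divide_less_eq mult.commute)
    obtain N where N: "\<And>n. n \<ge> N \<Longrightarrow> cmod ((\<integral>x. v n x * W k x \<partial>M) - (\<integral>x. v0 x * W k x \<partial>M)) < eps / 3"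
      using LIMSEQ_D[OF trunc, of "eps / 3"] eps by auto
    show "\<exists>N. \<forall>n\<ge>N. norm ((\<integral>x. v n x * w x \<partial>M) - (\<integral>x. v0 x * w x \<partial>M)) < eps"
    proof (intro exI allI impI)
      fix n assume "n \<ge> N"
      note N[OF this]
      moreover have "cmod ((\<integral>x. v n x * w x \<partial>M) - (\<integral>x. v n x * W k x \<partial>M)) < eps / 3"
        using close[OF assms(1) v2[of n] e(1), of k] e(2) k' by linarith
      moreover have "cmod ((\<integral>x. v0 x * w x \<partial>M) - (\<integral>x. v0 x * W k x \<partial>M)) < eps / 3"
        using close[OF assms(2) v02 e(1), of k] e(2) k' by linarith
      ultimately show "norm ((\<integral>x. v n x * w x \<partial>M) - (\<integral>x. v0 x * w x \<partial>M)) < eps"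
        by norm
    qed
  qed
qed

section \<open>The Fock space and its reproducing kernel\<close>

lemma cinner_add_left: "cinner (u + v) z = cinner u z + cinner v z"
  by (simp add: cinner_def sum.distrib algebra_simps)

lemma cinner_add_right: "cinner u (z + w) = cinner u z + cinner u w"
  by (simp add: cinner_def sum.distrib algebra_simps)

lemma cinner_scale_left: "cinner (c *s u) z = c * cinner u z"
  by (simp add: cinner_def sum_distrib_left algebra_simps)

lemma cnj_cinner: "cnj (cinner u z) = cinner z u"
  by (simp add: cinner_def mult.commute)

lemma cinner_zero_left [simp]: "cinner 0 z = 0"
  by (simp add: cinner_def)

lemma cinner_zero_right [simp]: "cinner z 0 = 0"
  by (simp add: cinner_def)

lemma norm_vec_power2: "(norm (z::complex^'n))\<^sup>2 = (\<Sum>j\<in>UNIV. (cmod (z $ j))\<^sup>2)"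
  by (simp add: norm_vec_def L2_set_def sum_nonneg)

lemma cinner_self: "cinner z z = complex_of_real ((norm z)\<^sup>2)"
  by (simp only: norm_vec_power2 cinner_def complex_norm_square of_real_sum)

lemma cmod_cinner_le: "cmod (cinner u z) \<le> norm u * norm z"
proof -
  have "cmod (cinner u z) \<le> (\<Sum>j\<in>UNIV. \<bar>cmod (u $ j)\<bar> * \<bar>cmod (z $ j)\<bar>)"
    unfolding cinner_def by (rule order_trans[OF norm_sum]) (simp add: norm_mult)
  also have "\<dots> \<le> norm u * norm z"
    unfolding norm_vec_def by (rule L2_set_mult_ineq)
  finally show ?thesis .
qed

lemma norm_scale_vec: "norm (c *s (u::complex^'n)) = cmod c * norm u"
proof -
  have "(norm (c *s u))\<^sup>2 = (cmod c * norm u)\<^sup>2"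
    by (simp add: power_mult_distrib norm_vec_power2 sum_distrib_left norm_mult)
  then show ?thesis by (simp add: power2_eq_iff_nonneg)
qed

lemma norm_add_vec_power2:
  "complex_of_real ((norm (u + v))\<^sup>2) = (norm u)\<^sup>2 + (norm v)\<^sup>2 + cinner u v + cinner v u"
  by (simp add: cinner_self[symmetric] cinner_add_left cinner_add_right del: of_real_power)

lemma continuous_on_cinner [continuous_intros]:
  "continuous_on S f \<Longrightarrow> continuous_on S g \<Longrightarrow> continuous_on S (\<lambda>x. cinner (f x) (g x))"
  unfolding cinner_def by (intro continuous_intros)

lemma continuous_on_scale_vec [continuous_intros]:
  fixes g :: "_ \<Rightarrow> complex^'n"
  shows "continuous_on S f \<Longrightarrow> continuous_on S g \<Longrightarrow> continuous_on S (\<lambda>x. f x *s g x)"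
  unfolding vector_scalar_mult_def by (intro continuous_intros)

lemma bounded_linear_cinner_left: "bounded_linear (\<lambda>u. cinner u z)"
proof -
  have "cinner (r *\<^sub>R u) z = r *\<^sub>R cinner u z" for r u
    by (simp add: cinner_def scaleR_sum_right)
  then have "linear (\<lambda>u. cinner u z)"
    by (intro linearI cinner_add_left)
  then show ?thesis by (simp add: linear_conv_bounded_linear)
qed

section \<open>Entire functions of several variables\<close>

lemma entire_fun_has_derivative:
  assumes "entire_fun f"
  obtains L where "(f has_derivative L) (at z)" "\<And>c x. L (c *s x) = c * L x"
  using assms unfolding entire_fun_def vector_scalar_mult_def by metis

lemma entire_funI:
  assumes "\<And>z. \<exists>L. (f has_derivative L) (at z) \<and> (\<forall>c x. L (c *s x) = c * L x)"
  shows "entire_fun f"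
  using assms unfolding entire_fun_def vector_scalar_mult_def by metis

lemma entire_fun_continuous:
  assumes "entire_fun f"
  shows "continuous_on UNIV f"
proof (intro continuous_at_imp_continuous_on ballI)
  fix z
  obtain L where "(f has_derivative L) (at z)" using entire_fun_has_derivative[OF assms] .
  then show "isCont f z" by (rule has_derivative_continuous)
qed

lemma entire_fun_measurable [measurable_dest]: "entire_fun f \<Longrightarrow> f \<in> borel_measurable borel"
  by (intro borel_measurable_continuous_onI entire_fun_continuous)

text \<open>Gives access to one-variable theory along complex lines. By the chain rule the
  derivative is \<open>c \<mapsto> L (c *s u)\<close>, and complex homogeneity of \<open>L\<close>
  makes it multiplication by the number \<open>L u\<close>.\<close>

lemma entire_fun_slice:
  assumes "entire_fun f"
  shows "(\<lambda>\<zeta>. f (a + \<zeta> *s u)) holomorphic_on S"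
proof -
  have "\<exists>D. ((\<lambda>\<zeta>. f (a + \<zeta> *s u)) has_field_derivative D) (at \<zeta>)" for \<zeta>
  proof -
    obtain L where L: "(f has_derivative L) (at (a + \<zeta> *s u))" "\<And>c x. L (c *s x) = c * L x"
      using entire_fun_has_derivative[OF assms] by blast
    have "linear (\<lambda>c. c *s u)"
      by (rule linearI) (simp_all add: vec_eq_iff algebra_simps)
    then have "((\<lambda>\<zeta>. a + \<zeta> *s u) has_derivative (\<lambda>c. c *s u)) (at \<zeta>)"
      by (auto intro!: derivative_eq_intros bounded_linear_imp_has_derivative simp: linear_conv_bounded_linear)
    from has_derivative_compose[OF this L(1)]
    have "((\<lambda>\<zeta>. f (a + \<zeta> *s u)) has_derivative (\<lambda>c. c * L u)) (at \<zeta>)"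
      by (simp add: L(2))
    then show ?thesis
      by (auto simp: has_field_derivative_def mult.commute[of _ "L u"])
  qed
  then show ?thesis
    by (meson field_differentiable_at_within field_differentiable_def holomorphic_onI)
qed

lemma entire_fun_mult:
  assumes "entire_fun f" "entire_fun g"
  shows "entire_fun (\<lambda>z. f z * g z)"
proof (rule entire_funI)
  fix z
  obtain L where L: "(f has_derivative L) (at z)" "\<And>c x. L (c *s x) = c * L x"
    using entire_fun_has_derivative[OF assms(1)] by blast
  obtain M where M: "(g has_derivative M) (at z)" "\<And>c x. M (c *s x) = c * M x"
    using entire_fun_has_derivative[OF assms(2)] by blast
  show "\<exists>L. ((\<lambda>z. f z * g z) has_derivative L) (at z) \<and> (\<forall>c x. L (c *s x) = c * L x)"
    by (intro exI conjI, rule has_derivative_mult[OF L(1) M(1)]) (simp add: L(2) M(2) algebra_simps)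
qed

lemma entire_fun_const: "entire_fun (\<lambda>_. c)"
  by (rule entire_funI, rule exI[of _ "\<lambda>_. 0"]) simp

lemma entire_fun_translate:
  assumes "entire_fun f"
  shows "entire_fun (\<lambda>z. f (a + z))"
proof (rule entire_funI)
  fix z
  obtain L where L: "(f has_derivative L) (at (a + z))" "\<And>c x. L (c *s x) = c * L x"
    using entire_fun_has_derivative[OF assms(1)] by blast
  have "((+) a has_derivative (\<lambda>x. x)) (at z)" by (auto intro!: derivative_eq_intros)
  from has_derivative_compose[OF this L(1)] L(2)
  show "\<exists>L. ((\<lambda>z. f (a + z)) has_derivative L) (at z) \<and> (\<forall>c x. L (c *s x) = c * L x)"
    by blast
qed

lemma entire_fun_exp_cinner: "entire_fun (\<lambda>u. exp (cinner u z))"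
proof (rule entire_funI)
  fix u
  have "((\<lambda>u. exp (cinner u z)) has_derivative (\<lambda>x. exp (cinner u z) * cinner x z)) (at u)"
    by (rule has_derivative_compose[of "\<lambda>u. cinner u z" "\<lambda>x. cinner x z" u UNIV exp "(*) (exp (cinner u z))"])
      (auto intro: bounded_linear_imp_has_derivative bounded_linear_cinner_left
        simp: DERIV_exp[unfolded has_field_derivative_def])
  then show "\<exists>L. ((\<lambda>u. exp (cinner u z)) has_derivative L) (at u) \<and> (\<forall>c x. L (c *s x) = c * L x)"
    by (intro exI conjI) (auto simp: cinner_scale_left)
qed

section \<open>Mean values over circles and over the Gaussian measure\<close>

text \<open>Cauchy's integral formula at the centre of the unit circle, parametrised by
  \<open>cis\<close>. The indicator form on the whole line is the one needed for Fubini.\<close>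

lemma circle_mean_value:
  fixes g :: "complex \<Rightarrow> complex"
  assumes "g holomorphic_on UNIV"
  shows "(\<integral>t. indicator {0..2*pi} t *\<^sub>R g (cis t) \<partial>lborel) = 2 * pi * g 0"
proof -
  have "((\<lambda>u. g u / (u - 0)) has_contour_integral (2 * of_real pi * \<i> * g 0)) (circlepath 0 1)"
    by (rule Cauchy_integral_circlepath_simple) (auto intro: holomorphic_on_subset[OF assms])
  then have "((\<lambda>t. g (cis t) * \<i>) has_integral (2 * of_real pi * \<i> * g 0)) {0..2*pi}"
    unfolding circlepath_def by (subst (asm) has_contour_integral_part_circlepath_iff) (auto simp: field_simps)
  from has_integral_mult_right[OF this, of "-\<i>"]
  have 1: "((\<lambda>t. g (cis t)) has_integral (2 * of_real pi * g 0)) {0..2*pi}"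
    by (simp add: mult_ac)
  have "continuous_on {0..2*pi} (\<lambda>t. g (cis t))"
    by (intro continuous_on_compose2[OF holomorphic_on_imp_continuous_on[OF assms]] continuous_intros) auto
  then have "set_integrable lborel {0..2*pi} (\<lambda>t. g (cis t))"
    by (intro borel_integrable_atLeastAtMost') auto
  from set_borel_integral_eq_integral(2)[OF this] 1 show ?thesis
    by (simp add: set_lebesgue_integral_def integral_unique)
qed

lemma integral_gauss_complex:
  "(\<integral>x. exp (- (norm (x::complex^'n))\<^sup>2) \<partial>lborel) = pi ^ CARD('n)"
proof -
  have "(\<integral>x. exp (- (norm (x::complex^'n))\<^sup>2) \<partial>lborel) = enn2real (ennreal (sqrt pi ^ DIM(complex^'n)))"
    by (subst integral_eq_nn_integral) (auto simp: nn_integral_gauss)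
  also have "sqrt pi ^ DIM(complex^'n) = pi ^ CARD('n)"
    by (simp add: mult.commute[of _ "2::nat"] power_mult)
  finally show ?thesis by simp
qed

text \<open>The Gaussian weight is invariant under \<open>u \<mapsto> cis t *s u\<close>, so the
  integral equals its average over \<open>t\<close>. By Fubini the average may be taken inside,
  where the mean value property on the complex line through \<open>u\<close> replaces
  \<open>F u\<close> by \<open>F 0\<close>.\<close>

lemma gauss_mean_value:
  fixes F :: "complex^'n \<Rightarrow> complex"
  assumes F: "entire_fun F" and int: "integrable lborel (\<lambda>u. F u * complex_of_real (exp (- (norm u)\<^sup>2)))"
  shows "(\<integral>u. F u * complex_of_real (exp (- (norm u)\<^sup>2)) \<partial>lborel) = pi ^ CARD('n) * F 0"
proof -
  define G where "G u = F u * complex_of_real (exp (- (norm u)\<^sup>2))" for u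
  have intG: "integrable lborel G" using int by (simp add: G_def[abs_def])
  have contG: "continuous_on UNIV G"
    unfolding G_def by (intro continuous_intros entire_fun_continuous F)
  have [measurable]: "G \<in> borel_measurable borel"
    by (rule borel_measurable_continuous_onI[OF contG])
  have rot: "distr lborel borel (\<lambda>u::complex^'n. cis t *s u) = lborel" for t
  proof (rule lborel_distr_isometry[of _ "\<lambda>u. cis (-t) *s u"])
    show "linear (\<lambda>u::complex^'n. cis t *s u)"
      by (rule linearI) (simp_all add: vec_eq_iff algebra_simps)
  qed (simp_all add: norm_scale_vec vector_smult_assoc cis_mult)
  have [measurable]: "(\<lambda>u::complex^'n. cis t *s u) \<in> borel_measurable borel" for t
    by (intro borel_measurable_continuous_onI continuous_intros)
  have rotI: "(\<integral>u. h (G (cis t *s u)) \<partial>lborel) = (\<integral>u. h (G u) \<partial>lborel)"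
    if [measurable]: "h \<in> borel_measurable borel" for t and h :: "complex \<Rightarrow> 'b::{banach, second_countable_topology}"
    by (subst (2) rot[of t, symmetric]) (simp add: integral_distr)
  have rotG: "integrable lborel (\<lambda>u. G (cis t *s u))" for t
    using intG by (subst (asm) rot[of t, symmetric]) (simp add: integrable_distr_eq)
  \<comment> \<open>\<open>H\<close> is integrated in both orders. Integrating over \<open>u\<close>
    first, rotation invariance gives \<open>2 * pi\<close> times the integral of \<open>G\<close>;
    integrating over \<open>t\<close> first, the circle mean gives \<open>2 * pi * F 0\<close> times
    the Gaussian.\<close>
  define H where "H = (\<lambda>(t, u). indicator {0..2*pi} t *\<^sub>R G (cis t *s u))"
  have meas: "(\<lambda>(t, u). G (cis t *s u)) \<in> borel_measurable (borel \<Otimes>\<^sub>M borel)"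
    unfolding borel_prod split_def
    by (intro borel_measurable_continuous_onI continuous_on_compose2[OF contG] continuous_intros) auto
  have [measurable]: "H \<in> borel_measurable (lborel \<Otimes>\<^sub>M lborel)"
    unfolding H_def using meas by measurable
  have H: "integrable (lborel \<Otimes>\<^sub>M lborel) H"
  proof (rule lborel_pair.Fubini_integrable)
    have "integrable lborel (\<lambda>t. indicator {0..2*pi} t *\<^sub>R (\<integral>u. norm (G u) \<partial>lborel))"
      by (rule integrable_scaleR_left) (simp add: integrable_indicator_iff)
    then show "integrable lborel (\<lambda>t. \<integral>u. norm (H (t, u)) \<partial>lborel)"
      by (simp add: H_def rotI[of norm])
    show "AE t in lborel. integrable lborel (\<lambda>u. H (t, u))"
      by (simp add: H_def rotG)
  qed measurable
  have "(\<integral>t. (\<integral>u. H (t, u) \<partial>lborel) \<partial>lborel) = (\<integral>t. indicator {0..2*pi} t *\<^sub>R (\<integral>u. G u \<partial>lborel) \<partial>lborel)"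
    by (simp add: H_def rotI[of "\<lambda>x. x"])
  also have "\<dots> = 2 * pi * (\<integral>u. G u \<partial>lborel)"
    by (simp add: scaleR_conv_of_real)
  finally have 1: "(\<integral>t. (\<integral>u. H (t, u) \<partial>lborel) \<partial>lborel) = 2 * pi * (\<integral>u. G u \<partial>lborel)" .
  have "(\<integral>t. H (t, u) \<partial>lborel) = 2 * pi * F 0 * exp (- (norm u)\<^sup>2)" for u
  proof -
    have "(\<integral>t. H (t, u) \<partial>lborel)
        = (\<integral>t. (indicator {0..2*pi} t *\<^sub>R F (0 + cis t *s u)) * complex_of_real (exp (- (norm u)\<^sup>2)) \<partial>lborel)"
      by (simp add: H_def G_def norm_scale_vec)
    also have "\<dots> = (\<integral>t. indicator {0..2*pi} t *\<^sub>R F (0 + cis t *s u) \<partial>lborel) * complex_of_real (exp (- (norm u)\<^sup>2))"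
      by (rule integral_mult_left_zero)
    also have "\<dots> = 2 * pi * F 0 * exp (- (norm u)\<^sup>2)"
      using circle_mean_value[OF entire_fun_slice[OF F, of 0 u]] by simp
    finally show ?thesis .
  qed
  then have "(\<integral>u. (\<integral>t. H (t, u) \<partial>lborel) \<partial>lborel) = 2 * pi * F 0 * (\<integral>u. exp (- (norm (u::complex^'n))\<^sup>2) \<partial>lborel)"
    by simp
  also have "\<dots> = 2 * pi * (pi ^ CARD('n) * F 0)"
    by (simp only: integral_gauss_complex) (simp add: mult_ac)
  finally have 2: "(\<integral>u. (\<integral>t. H (t, u) \<partial>lborel) \<partial>lborel) = 2 * pi * (pi ^ CARD('n) * F 0)" .
  have "(\<integral>u. (\<integral>t. H (t, u) \<partial>lborel) \<partial>lborel) = (\<integral>t. (\<integral>u. H (t, u) \<partial>lborel) \<partial>lborel)"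
    using lborel_pair.Fubini_integral[of "\<lambda>t u. H (t, u)"] H by simp
  with 1 2 have "2 * pi * (\<integral>u. G u \<partial>lborel) = 2 * pi * (pi ^ CARD('n) * F 0)" by simp
  then show ?thesis by (simp add: G_def)
qed

section \<open>Integrability, reproducing formula and growth in the Fock space\<close>

lemma fock_entire: "f \<in> fock \<Longrightarrow> entire_fun f"
  by (simp add: fock_def)

lemma fock_integrable: "f \<in> fock \<Longrightarrow> integrable lborel (\<lambda>z. (cmod (f z))\<^sup>2 * exp (- (norm z)\<^sup>2))"
  by (simp add: fock_def)

lemma fock_integrable_exp:
  fixes f :: "complex^'n \<Rightarrow> complex"
  assumes f: "f \<in> fock" and b: "b < 1/2"
  shows "integrable lborel (\<lambda>z. cmod (f z) * exp (a * norm z + b * (norm z)\<^sup>2 - (norm z)\<^sup>2))"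
proof (rule Bochner_Integration.integrable_bound)
  have [measurable]: "f \<in> borel_measurable borel" using f by (intro entire_fun_measurable fock_entire)
  show "(\<lambda>z. cmod (f z) * exp (a * norm z + b * (norm z)\<^sup>2 - (norm z)\<^sup>2)) \<in> borel_measurable lborel"
    by measurable
  show "integrable lborel (\<lambda>z::complex^'n. (cmod (f z))\<^sup>2 * exp (- (norm z)\<^sup>2)
      + exp ((2 * a) * norm z - (1 - 2 * b) * (norm z)\<^sup>2))"
    using b by (intro Bochner_Integration.integrable_add fock_integrable f integrable_exp_norm) auto
  have "cmod (f z) * exp (a * norm z + b * (norm z)\<^sup>2 - (norm z)\<^sup>2)
     \<le> (cmod (f z))\<^sup>2 * exp (- (norm z)\<^sup>2) + exp ((2 * a) * norm z - (1 - 2 * b) * (norm z)\<^sup>2)" for z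
  proof -
    let ?x = "cmod (f z) * exp (- (norm z)\<^sup>2 / 2)" and ?y = "exp (a * norm z + b * (norm z)\<^sup>2 - (norm z)\<^sup>2 / 2)"
    have "cmod (f z) * exp (a * norm z + b * (norm z)\<^sup>2 - (norm z)\<^sup>2) = ?x * ?y"
      by (simp add: mult.assoc exp_add[symmetric])
    also have "\<dots> \<le> ?x\<^sup>2 + ?y\<^sup>2"
      using weighted_am_gm[of ?x ?y 1] by simp
    also have "?x\<^sup>2 = (cmod (f z))\<^sup>2 * exp (- (norm z)\<^sup>2)"
      by (simp add: power_mult_distrib exp_double[symmetric])
    also have "?y\<^sup>2 = exp ((2 * a) * norm z - (1 - 2 * b) * (norm z)\<^sup>2)"
      by (simp add: exp_double[symmetric] algebra_simps)
    finally show ?thesis .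
  qed
  then show "AE z in lborel. norm (cmod (f z) * exp (a * norm z + b * (norm z)\<^sup>2 - (norm z)\<^sup>2))
     \<le> norm ((cmod (f z))\<^sup>2 * exp (- (norm z)\<^sup>2) + exp ((2 * a) * norm z - (1 - 2 * b) * (norm z)\<^sup>2))"
    by (intro AE_I2) simp
qed

definition fock_kernel :: "complex^'n \<Rightarrow> complex^'n \<Rightarrow> complex" where
  "fock_kernel z = (\<lambda>u. exp (cinner u z))"

lemma fock_scale:
  assumes "f \<in> fock"
  shows "(\<lambda>z. c * f z) \<in> fock"
  using assms by (auto simp: fock_def norm_mult power_mult_distrib mult.assoc intro: entire_fun_mult entire_fun_const)

lemma fock_kernel_in_fock: "fock_kernel z \<in> fock"
proof -
  have "integrable lborel (\<lambda>u. (cmod (fock_kernel z u))\<^sup>2 * exp (- (norm u)\<^sup>2))"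
  proof (rule Bochner_Integration.integrable_bound[OF integrable_exp_norm[of 1 "2 * norm z"]])
    have "entire_fun (fock_kernel z)" unfolding fock_kernel_def by (rule entire_fun_exp_cinner)
    note [measurable] = entire_fun_measurable[OF this]
    show "(\<lambda>u. (cmod (fock_kernel z u))\<^sup>2 * exp (- (norm u)\<^sup>2)) \<in> borel_measurable lborel" by measurable
    have "(cmod (fock_kernel z u))\<^sup>2 * exp (- (norm u)\<^sup>2) \<le> exp (2 * norm z * norm u - 1 * (norm u)\<^sup>2)" for u
    proof -
      have "(cmod (fock_kernel z u))\<^sup>2 * exp (- (norm u)\<^sup>2) = exp (2 * Re (cinner u z) - (norm u)\<^sup>2)"
        by (simp add: fock_kernel_def exp_double[symmetric] exp_add[symmetric])
      also have "\<dots> \<le> exp (2 * norm z * norm u - 1 * (norm u)\<^sup>2)"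
        using order_trans[OF complex_Re_le_cmod cmod_cinner_le[of u z]] by (simp add: mult.commute)
      finally show ?thesis .
    qed
    then show "AE u in lborel. norm ((cmod (fock_kernel z u))\<^sup>2 * exp (- (norm u)\<^sup>2))
        \<le> norm (exp (2 * norm z * norm u - 1 * (norm u)\<^sup>2))"
      by (intro AE_I2) simp
  qed simp
  then show ?thesis
    by (simp add: fock_def fock_kernel_def entire_fun_exp_cinner)
qed

lemma fock_integrable_kernel:
  fixes f :: "complex^'n \<Rightarrow> complex"
  assumes f: "f \<in> fock"
  shows "integrable lborel (\<lambda>w. f w * exp (cinner z w) * complex_of_real (exp (- (norm w)\<^sup>2)))"
proof (rule Bochner_Integration.integrable_bound[OF fock_integrable_exp[OF f, of 0 "norm z"]])
  have "continuous_on UNIV (\<lambda>w. f w * exp (cinner z w) * complex_of_real (exp (- (norm w)\<^sup>2)))"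
    by (intro continuous_intros entire_fun_continuous fock_entire f)
  from borel_measurable_continuous_onI[OF this]
  show "(\<lambda>w. f w * exp (cinner z w) * complex_of_real (exp (- (norm w)\<^sup>2))) \<in> borel_measurable lborel"
    by simp
  have "Re (cinner z w) \<le> norm z * norm w" for w
    by (rule order_trans[OF complex_Re_le_cmod cmod_cinner_le])
  then show "AE w in lborel. norm (f w * exp (cinner z w) * complex_of_real (exp (- (norm w)\<^sup>2)))
      \<le> norm (cmod (f w) * exp (norm z * norm w + 0 * (norm w)\<^sup>2 - (norm w)\<^sup>2))"
    by (intro AE_I2) (simp add: norm_mult mult.assoc exp_add[symmetric] mult_left_mono)
qed simp

text \<open>After the substitution \<open>w = z + u\<close> the kernel and the weight combine to
  \<open>exp (- cinner u z)\<close> times the Gaussian in \<open>u\<close>. The Gaussian mean value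
  then evaluates the entire function \<open>F\<close> at 0, and \<open>F 0 = f z\<close>. The factor
  \<open>pi ^ CARD('n)\<close> is the normalisation contained in \<open>fock_inner\<close>.\<close>

lemma fock_reproducing:
  fixes f :: "complex^'n \<Rightarrow> complex"
  assumes f: "f \<in> fock"
  shows "(\<integral>w. f w * exp (cinner z w) * complex_of_real (exp (- (norm w)\<^sup>2)) \<partial>lborel) = pi ^ CARD('n) * f z"
proof -
  define G where "G w = f w * exp (cinner z w) * complex_of_real (exp (- (norm w)\<^sup>2))" for w
  define F where "F u = f (z + u) * (exp (cinner u (- z)))" for u
  have intG: "integrable lborel G"
    unfolding G_def by (rule fock_integrable_kernel[OF f])
  then have [measurable]: "G \<in> borel_measurable borel" by auto
  have eq: "G (z + u) = F u * complex_of_real (exp (- (norm u)\<^sup>2))" for u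
  proof -
    have "exp (cinner z (z + u)) * complex_of_real (exp (- (norm (z + u))\<^sup>2))
        = exp (cinner u (- z)) * complex_of_real (exp (- (norm u)\<^sup>2))"
      unfolding exp_of_real[symmetric] exp_add[symmetric] of_real_minus norm_add_vec_power2
      by (simp add: cinner_add_right cinner_self) (simp add: cinner_def sum_negf)
    then show ?thesis by (simp add: G_def F_def mult.assoc)
  qed
  have "(\<integral>w. G w \<partial>lborel) = (\<integral>u. G (z + u) \<partial>lborel)"
    by (subst lborel_distr_plus[of z, symmetric]) (simp add: integral_distr)
  also have "\<dots> = (\<integral>u. F u * complex_of_real (exp (- (norm u)\<^sup>2)) \<partial>lborel)"
    by (simp add: eq)
  also have "\<dots> = pi ^ CARD('n) * F 0"
  proof (rule gauss_mean_value)
    show "entire_fun F" unfolding F_def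
      by (intro entire_fun_mult entire_fun_translate entire_fun_exp_cinner fock_entire f)
    have "integrable lborel (\<lambda>u. G (z + u))"
      using intG by (subst (asm) lborel_distr_plus[of z, symmetric]) (simp add: integrable_distr_eq)
    then show "integrable lborel (\<lambda>u. F u * complex_of_real (exp (- (norm u)\<^sup>2)))"
      by (simp add: eq)
  qed
  finally show ?thesis by (simp add: G_def F_def)
qed

lemma fock_inner_kernel:
  assumes "f \<in> fock"
  shows "fock_inner f (fock_kernel z) = f z"
  using fock_reproducing[OF assms, of z]
  by (simp add: fock_inner_def fock_kernel_def exp_cnj cnj_cinner)

lemma cnj_fock_inner: "cnj (fock_inner f g) = fock_inner g f"
proof -
  have "cnj (\<integral>z. f z * cnj (g z) * complex_of_real (exp (- (norm z)\<^sup>2)) \<partial>lborel)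
      = (\<integral>z. g z * cnj (f z) * complex_of_real (exp (- (norm z)\<^sup>2)) \<partial>lborel)"
    by (subst Bochner_Integration.integral_cnj[symmetric]) (simp add: mult_ac del: Bochner_Integration.integral_cnj)
  then show ?thesis by (simp add: fock_inner_def)
qed

lemma fock_inner_scale_left: "fock_inner (\<lambda>z. c * f z) g = c * fock_inner f g"
  by (simp add: fock_inner_def mult.assoc)

lemma fock_inner_scale_right: "fock_inner f (\<lambda>z. c * g z) = cnj c * fock_inner f g"
  by (subst (1 2) cnj_fock_inner[symmetric]) (simp add: fock_inner_scale_left)

text \<open>The reproducing formula is estimated with weight
  \<open>exp ((norm z)\<^sup>2 / 2)\<close> in \<open>weighted_am_gm\<close>. This weight is, up to
  the power of \<open>pi\<close>, the norm of the kernel at \<open>z\<close>, so both resulting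
  terms are multiples of it.\<close>

lemma fock_pointwise_bound:
  fixes f :: "complex^'n \<Rightarrow> complex"
  assumes f: "f \<in> fock"
  obtains C where "C \<ge> 0" "\<And>z. cmod (f z) \<le> C * exp ((norm z)\<^sup>2 / 2)"
proof
  define N where "N = (\<integral>w. (cmod (f w))\<^sup>2 * exp (- (norm w)\<^sup>2) \<partial>lborel)"
  define P where "P = pi ^ CARD('n)"
  have P: "P > 0" by (simp add: P_def)
  have N: "N \<ge> 0" unfolding N_def by (rule integral_nonneg_AE) simp
  show "0 \<le> (N + P) / P" using N P by simp
  show "cmod (f z) \<le> (N + P) / P * exp ((norm z)\<^sup>2 / 2)" for z
  proof -
    let ?E = "exp ((norm z)\<^sup>2 / 2)"
    let ?k = "\<lambda>w. (cmod (fock_kernel z w))\<^sup>2 * exp (- (norm w)\<^sup>2)"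
    \<comment> \<open>The squared norm of the kernel is the kernel's value at its own base point, by
      the reproducing formula applied to the kernel itself.\<close>
    have k: "(\<integral>w. ?k w \<partial>lborel) = P * ?E\<^sup>2"
    proof -
      have "complex_of_real (\<integral>w. ?k w \<partial>lborel) = (\<integral>w. complex_of_real (?k w) \<partial>lborel)"
        by (rule integral_complex_of_real[symmetric])
      also have "\<dots> = (\<integral>w. fock_kernel z w * exp (cinner z w) * complex_of_real (exp (- (norm w)\<^sup>2)) \<partial>lborel)"
        by (rule Bochner_Integration.integral_cong[OF refl])
          (simp only: of_real_mult complex_norm_square, simp add: fock_kernel_def exp_cnj cnj_cinner)
      also have "\<dots> = P * fock_kernel z z"
        using fock_reproducing[OF fock_kernel_in_fock, of z z] by (simp add: P_def)
      also have "fock_kernel z z = complex_of_real (?E\<^sup>2)"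
        by (simp add: fock_kernel_def cinner_self exp_of_real exp_double[symmetric] del: of_real_power)
      finally show ?thesis by (simp only: of_real_mult[symmetric] of_real_eq_iff)
    qed
    have "P * cmod (f z) = cmod (\<integral>w. f w * exp (cinner z w) * complex_of_real (exp (- (norm w)\<^sup>2)) \<partial>lborel)"
      using fock_reproducing[OF f, of z] P by (simp add: P_def norm_mult norm_power)
    also have "\<dots> \<le> (\<integral>w. ?E * ((cmod (f w))\<^sup>2 * exp (- (norm w)\<^sup>2)) + ?k w / ?E \<partial>lborel)"
    proof (rule order_trans[OF integral_norm_bound], rule integral_mono)
      show "integrable lborel (\<lambda>w. norm (f w * exp (cinner z w) * complex_of_real (exp (- (norm w)\<^sup>2))))"
        by (rule integrable_norm, rule fock_integrable_kernel[OF f])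
      show "integrable lborel (\<lambda>w. ?E * ((cmod (f w))\<^sup>2 * exp (- (norm w)\<^sup>2)) + ?k w / ?E)"
        using fock_integrable[OF f] fock_integrable[OF fock_kernel_in_fock, of z] by simp
      show "norm (f w * exp (cinner z w) * complex_of_real (exp (- (norm w)\<^sup>2)))
          \<le> ?E * ((cmod (f w))\<^sup>2 * exp (- (norm w)\<^sup>2)) + ?k w / ?E" for w
      proof -
        have "cmod (exp (cinner z w)) = cmod (fock_kernel z w)"
          unfolding fock_kernel_def by (subst cnj_cinner[symmetric], subst exp_cnj[symmetric]) simp
        then have "norm (f w * exp (cinner z w) * complex_of_real (exp (- (norm w)\<^sup>2)))
          = (cmod (f w) * cmod (fock_kernel z w)) * exp (- (norm w)\<^sup>2)"
          by (simp add: norm_mult)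
        also have "\<dots> \<le> (?E * (cmod (f w))\<^sup>2 + (cmod (fock_kernel z w))\<^sup>2 / ?E) * exp (- (norm w)\<^sup>2)"
          by (intro mult_right_mono weighted_am_gm) auto
        finally show ?thesis by (simp add: algebra_simps)
      qed
    qed
    also have "\<dots> = ?E * N + P * ?E\<^sup>2 / ?E"
      using fock_integrable[OF f] fock_integrable[OF fock_kernel_in_fock, of z]
      by (simp add: N_def k)
    also have "\<dots> = (N + P) * ?E"
      by (simp add: power2_eq_square algebra_simps)
    finally show ?thesis using P by (simp add: field_simps)
  qed
qed

section \<open>Holomorphic dependence on the dilation parameter\<close>

lemma integral_lborel_scale:
  fixes f :: "'a::euclidean_space \<Rightarrow> real"
  assumes f: "integrable lborel f" and c: "c \<noteq> 0"
  shows "integrable lborel (\<lambda>x. f (c *\<^sub>R x))"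
    and "(\<integral>x. f (c *\<^sub>R x) \<partial>lborel) = (\<integral>x. f x \<partial>lborel) / \<bar>c\<bar> ^ DIM('a)"
proof -
  have [measurable]: "f \<in> borel_measurable borel" using f by auto
  have "integrable (density (distr lborel borel (\<lambda>x. 0 + c *\<^sub>R x)) (\<lambda>_. ennreal (\<bar>c\<bar> ^ DIM('a)))) f"
    using f by (subst (asm) lborel_affine[OF c, of 0]) simp
  then have "integrable (distr lborel borel (\<lambda>x. 0 + c *\<^sub>R x)) (\<lambda>x. \<bar>c\<bar> ^ DIM('a) *\<^sub>R f x)"
    by (subst (asm) integrable_density) auto
  then have "integrable lborel (\<lambda>x. \<bar>c\<bar> ^ DIM('a) *\<^sub>R f (c *\<^sub>R x))"
    by (subst (asm) integrable_distr_eq) auto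
  then show "integrable lborel (\<lambda>x. f (c *\<^sub>R x))" using c by simp
  have "(\<integral>x. f x \<partial>lborel) = \<bar>c\<bar> ^ DIM('a) * (\<integral>x. f (c *\<^sub>R x) \<partial>lborel)"
    by (subst lborel_affine[OF c, of 0]) (simp add: integral_density integral_distr)
  then show "(\<integral>x. f (c *\<^sub>R x) \<partial>lborel) = (\<integral>x. f x \<partial>lborel) / \<bar>c\<bar> ^ DIM('a)"
    using c by simp
qed

text \<open>Discs of radius \<open>e/4\<close> about points of the half-size disc stay inside the
  full one, so Cauchy's estimate bounds the derivative there by \<open>4 * B / e\<close>. The bound
  depends on \<open>f\<close> only through \<open>B\<close>, which allows it to be integrated
  afterwards.\<close>

lemma holomorphic_lipschitz_of_bound:
  assumes hol: "f holomorphic_on ball a e" and e: "e > 0"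
    and bd: "\<And>r. r \<in> ball a e \<Longrightarrow> cmod (f r) \<le> B"
    and x: "x \<in> ball a (e/2)" and y: "y \<in> ball a (e/2)"
  shows "cmod (f x - f y) \<le> 4 * B / e * cmod (x - y)"
proof (rule field_differentiable_bound[OF convex_ball _ _ x y])
  fix r assume r: "r \<in> ball a (e/2)"
  then have r': "r \<in> ball a e" using e by simp
  show "(f has_field_derivative deriv f r) (at r within ball a (e/2))"
    by (rule has_field_derivative_at_within, rule holomorphic_derivI[OF hol open_ball r'])
  have sub: "cball r (e/4) \<subseteq> ball a e"
  proof
    fix t assume "t \<in> cball r (e/4)"
    then show "t \<in> ball a e"
      using r e dist_triangle[of a t r] by simp
  qed
  have "cmod ((deriv ^^ 1) f r) \<le> fact 1 * B / (e/4) ^ 1"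
  proof (rule Cauchy_inequality)
    show "f holomorphic_on ball r (e/4)"
      using hol sub ball_subset_cball by (meson holomorphic_on_subset subset_trans)
    show "continuous_on (cball r (e/4)) f"
      using hol sub by (meson holomorphic_on_imp_continuous_on continuous_on_subset)
    show "cmod (f t) \<le> B" if "cmod (r - t) = e/4" for t
      using that sub by (intro bd) (auto simp: dist_norm)
  qed (use e in simp)
  then show "cmod (deriv f r) \<le> 4 * B / e" by (simp add: mult.commute)
qed

text \<open>Differentiation under the integral sign without a hypothesis on the derivative: the
  Lipschitz bound dominates all difference quotients at \<open>a\<close> by
  \<open>4 * G x / e\<close>, and dominated convergence applies along every sequence tending to
  \<open>a\<close>.\<close>

lemma field_differentiable_integral:
  fixes F :: "complex \<Rightarrow> 'a \<Rightarrow> complex"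
  assumes e: "e > 0"
    and hol: "\<And>x. (\<lambda>r. F r x) holomorphic_on ball a e"
    and int: "\<And>r. r \<in> ball a e \<Longrightarrow> integrable M (F r)"
    and G: "integrable M G" and bd: "\<And>r x. r \<in> ball a e \<Longrightarrow> cmod (F r x) \<le> G x"
  shows "(\<lambda>r. \<integral>x. F r x \<partial>M) field_differentiable (at a)"
proof -
  define D where "D x = deriv (\<lambda>r. F r x) a" for x
  define I where "I r = (\<integral>x. F r x \<partial>M)" for r
  have a: "a \<in> ball a e" "a \<in> ball a (e/2)" using e by auto
  have "(\<lambda>n. (I (X n) - I a) / (X n - a)) \<longlonglongrightarrow> (\<integral>x. D x \<partial>M)"
    if X: "\<And>n. X n \<noteq> a" "X \<longlonglongrightarrow> a" for X
  proof -
    obtain N where N: "\<And>n. n \<ge> N \<Longrightarrow> X n \<in> ball a (e/2)"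
      using metric_LIMSEQ_D[OF X(2), of "e/2"] e by (auto simp: dist_commute)
    \<comment> \<open>Only a tail of \<open>X\<close> is sure to lie in the half-size disc, where
      the Lipschitz bound holds.\<close>
    define Y where "Y n = X (n + N)" for n
    have Y: "Y n \<noteq> a" "Y n \<in> ball a (e/2)" "Y n \<in> ball a e" "Y \<longlonglongrightarrow> a" for n
      using X N[of "n + N"] e LIMSEQ_ignore_initial_segment[OF X(2), of N] by (auto simp: Y_def[abs_def])
    let ?q = "\<lambda>n x. (F (Y n) x - F a x) / (Y n - a)"
    have intq: "integrable M (?q n)" for n
      using int[OF Y(3)] int[OF a(1)] by simp
    have lim: "(\<lambda>n. ?q n x) \<longlonglongrightarrow> D x" for x
    proof -
      have "((\<lambda>r. F r x) has_field_derivative D x) (at a)"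
        unfolding D_def by (rule holomorphic_derivI[OF hol open_ball a(1)])
      then have "((\<lambda>r. (F r x - F a x) / (r - a)) \<longlongrightarrow> D x) (at a)"
        by (simp add: has_field_derivative_iff)
      moreover have "filterlim Y (at a) sequentially"
        using Y by (auto simp: filterlim_at)
      ultimately show ?thesis by (rule filterlim_compose)
    qed
    have [measurable]: "?q n \<in> borel_measurable M" for n using intq by (rule borel_measurable_integrable)
    have "(\<lambda>n. \<integral>x. ?q n x \<partial>M) \<longlonglongrightarrow> (\<integral>x. D x \<partial>M)"
    proof (rule integral_dominated_convergence)
      show "D \<in> borel_measurable M"
        by (rule borel_measurable_LIMSEQ_metric[of ?q]) (auto intro: lim)
      show "integrable M (\<lambda>x. 4 * G x / e)" using G by simp
      show "AE x in M. (\<lambda>n. ?q n x) \<longlonglongrightarrow> D x" by (intro AE_I2 lim)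
      show "AE x in M. norm (?q n x) \<le> 4 * G x / e" for n
      proof (intro AE_I2)
        fix x
        have "cmod (F (Y n) x - F a x) \<le> 4 * G x / e * cmod (Y n - a)"
          by (rule holomorphic_lipschitz_of_bound[OF hol e bd Y(2) a(2)])
        then show "norm (?q n x) \<le> 4 * G x / e"
          using Y(1)[of n] by (simp add: norm_divide pos_divide_le_eq)
      qed
    qed measurable
    moreover have "(\<integral>x. ?q n x \<partial>M) = (I (Y n) - I a) / (Y n - a)" for n
      using int[OF Y(3)] int[OF a(1)] by (simp add: I_def)
    ultimately have "(\<lambda>n. (I (Y n) - I a) / (Y n - a)) \<longlonglongrightarrow> (\<integral>x. D x \<partial>M)" by (simp only:)
    then show ?thesis unfolding Y_def by (rule LIMSEQ_offset)
  qed
  then have "(I has_field_derivative (\<integral>x. D x \<partial>M)) (at a)"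
    unfolding has_field_derivative_iff tendsto_at_iff_sequentially comp_def by auto
  then show ?thesis
    unfolding I_def field_differentiable_def by blast
qed

text \<open>For \<open>q = 0\<close> this is \<open>\<langle>h(r \<cdot>), g\<rangle>\<close> up to the constant \<open>\<pi>\<^sup>d\<close>. If \<open>h = \<theta> e\<^bsup>\<langle>\<cdot>,q\<rangle>\<^esup> (f \<circ> \<phi>)\<close>
  with \<open>\<phi> z = A z + q\<close>, the factor \<open>e\<^bsup>(1-r)\<langle>z,q\<rangle>\<^esup>\<close> turns the dilate of \<open>h\<close> into
  \<open>\<theta> e\<^bsup>\<langle>z,q\<rangle>\<^esup> f(r A z + q)\<close>: the same operator, with \<open>r A\<close> in place of \<open>A\<close>.\<close>
definition twisted_dilation ::
  "complex^'n \<Rightarrow> (complex^'n \<Rightarrow> complex) \<Rightarrow> (complex^'n \<Rightarrow> complex) \<Rightarrow> complex \<Rightarrow> complex" where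
  "twisted_dilation q h g r = (\<integral>z. exp ((1 - r) * cinner z q) * h (r *s z) * cnj (g z) *
      complex_of_real (exp (- (norm z)\<^sup>2)) \<partial>lborel)"

section \<open>Twisted dilations: holomorphy in the disc and the limit at 1\<close>

text \<open>For \<open>cmod r \<le> \<rho> < 1\<close> the pointwise bound on \<open>h\<close>
  leaves the growth \<open>exp (\<rho>\<^sup>2 / 2 * (norm z)\<^sup>2)\<close>, whose coefficient is
  below \<open>1/2\<close>. Hence \<open>fock_integrable_exp\<close> for \<open>g\<close> supplies a
  majorant that is locally uniform in \<open>r\<close>.\<close>

lemma twisted_dilation_holomorphic:
  fixes g h :: "complex^'n \<Rightarrow> complex"
  assumes h: "h \<in> fock" and g: "g \<in> fock"
  shows "twisted_dilation q h g holomorphic_on ball 0 1"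
proof -
  define F where "F r z = exp ((1 - r) * cinner z q) * h (r *s z) * cnj (g z) *
      complex_of_real (exp (- (norm z)\<^sup>2))" for r z
  obtain C where C: "C \<ge> 0" "\<And>z. cmod (h z) \<le> C * exp ((norm z)\<^sup>2 / 2)"
    using fock_pointwise_bound[OF h] by blast
  have ch: "continuous_on UNIV h" and cg: "continuous_on UNIV g"
    using h g by (auto intro: entire_fun_continuous fock_entire)
  have F_meas: "F r \<in> borel_measurable lborel" for r
  proof -
    have "continuous_on UNIV (F r)" unfolding F_def
      by (intro continuous_intros continuous_on_compose2[OF ch] cg) auto
    from borel_measurable_continuous_onI[OF this] show ?thesis by simp
  qed
  have "twisted_dilation q h g field_differentiable (at a)" if a: "a \<in> ball 0 1" for a
  proof -
    \<comment> \<open>Half the distance from \<open>a\<close> to the unit circle, so that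
      \<open>\<rho> = (1 + cmod a) / 2\<close> bounds \<open>cmod r\<close> on the disc about
      \<open>a\<close>.\<close>
    define e where "e = (1 - cmod a) / 2"
    define \<rho> where "\<rho> = cmod a + e"
    have e: "e > 0" and \<rho>: "0 \<le> \<rho>" "\<rho> < 1" using a by (auto simp: e_def \<rho>_def field_simps)
    define G where "G z = C * (cmod (g z) * exp ((2 * norm q) * norm z + \<rho>\<^sup>2 / 2 * (norm z)\<^sup>2 - (norm z)\<^sup>2))" for z
    have G: "integrable lborel G"
      unfolding G_def using \<rho> by (intro integrable_mult_right fock_integrable_exp g) (simp add: power_less_one_iff)
    have bd: "cmod (F r z) \<le> G z" if r: "r \<in> ball a e" for r z
    proof -
      have r\<rho>: "cmod r \<le> \<rho>" using r norm_triangle_sub[of r a] by (simp add: \<rho>_def dist_norm norm_minus_commute)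
      have "cmod (1 - r) \<le> 2" using norm_triangle_ineq4[of 1 r] r\<rho> \<rho> by simp
      then have "cmod ((1 - r) * cinner z q) \<le> 2 * (norm z * norm q)"
        unfolding norm_mult by (intro mult_mono cmod_cinner_le) auto
      then have 1: "Re ((1 - r) * cinner z q) \<le> 2 * norm q * norm z"
        using complex_Re_le_cmod[of "(1 - r) * cinner z q"] by (simp add: mult_ac)
      have "(cmod r * norm z)\<^sup>2 \<le> (\<rho> * norm z)\<^sup>2"
        using r\<rho> by (intro power_mono mult_right_mono) auto
      then have 2: "cmod (h (r *s z)) \<le> C * exp (\<rho>\<^sup>2 / 2 * (norm z)\<^sup>2)"
        using C(1) by (intro order_trans[OF C(2)] mult_left_mono) (auto simp: norm_scale_vec power_mult_distrib)
      have "cmod (F r z) \<le> exp (2 * norm q * norm z) * (C * exp (\<rho>\<^sup>2 / 2 * (norm z)\<^sup>2)) * cmod (g z) * exp (- (norm z)\<^sup>2)"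
        unfolding F_def norm_mult using 1 2 by (intro mult_mono mult_nonneg_nonneg C(1)) auto
      also have "\<dots> = G z"
        unfolding G_def diff_conv_add_uminus exp_add by (simp add: mult_ac)
      finally show ?thesis .
    qed
    show ?thesis unfolding twisted_dilation_def[abs_def] F_def[symmetric]
    proof (rule field_differentiable_integral[OF e _ _ G bd])
      show "(\<lambda>r. F r z) holomorphic_on ball a e" for z
        using entire_fun_slice[OF fock_entire[OF h], of 0 z "ball a e"]
        unfolding F_def by (intro holomorphic_intros) simp
      show "integrable lborel (F r)" if "r \<in> ball a e" for r
        using bd[OF that] by (intro Bochner_Integration.integrable_bound[OF G F_meas]) (auto intro: order_trans[OF _ abs_ge_self])
    qed
  qed
  then show ?thesis
    by (meson field_differentiable_at_within holomorphic_onI)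
qed

text \<open>The majorants used inside the disc are lost at \<open>r = 1\<close>, so the limit is
  taken weakly. The twisted dilates stay bounded in norm: the twist costs at most
  \<open>exp ((norm q)\<^sup>2)\<close> in the squared norm, and the Jacobian of the dilation is
  controlled because \<open>r n\<close> starts at \<open>1/2\<close>.\<close>

lemma twisted_dilation_tendsto:
  fixes g h :: "complex^'n \<Rightarrow> complex"
  assumes h: "h \<in> fock" and g: "g \<in> fock"
  defines "r \<equiv> \<lambda>n. 1 - 1 / (real n + 2)"
  shows "(\<lambda>n. twisted_dilation q h g (of_real (r n))) \<longlonglongrightarrow> pi ^ CARD('n) * fock_inner h g"
proof -
  have r: "1/2 \<le> r n" "r n < 1" for n unfolding r_def by (auto simp: field_simps)
  have r_lim: "r \<longlonglongrightarrow> 1" unfolding r_def by real_asymp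
  obtain C where C: "C \<ge> 0" "\<And>z. cmod (h z) \<le> C * exp ((norm z)\<^sup>2 / 2)"
    using fock_pointwise_bound[OF h] by blast
  have ch: "continuous_on UNIV h" and cg: "continuous_on UNIV g"
    using h g by (auto intro: entire_fun_continuous fock_entire)
  \<comment> \<open>The square root of the Gaussian weight. One copy in each factor turns Fock norms
    into plain \<open>L\<^sup>2\<close> norms for Lebesgue measure.\<close>
  define E where "E z = complex_of_real (exp (- (norm z)\<^sup>2 / 2))" for z :: "complex^'n"
  have EE: "x * E z * (y * E z) = x * y * complex_of_real (exp (- (norm z)\<^sup>2))" for x y z
    by (simp add: E_def of_real_mult[symmetric] exp_add[symmetric] del: of_real_mult)
  define v where "v n z = exp ((1 - of_real (r n)) * cinner z q) * h (of_real (r n) *s z) * E z" for n z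
  define v0 where "v0 z = h z * E z" for z
  define w where "w z = cnj (g z) * E z" for z
  have norm2E: "(cmod (x * E z))\<^sup>2 = (cmod x)\<^sup>2 * exp (- (norm z)\<^sup>2)" for x z
    by (simp add: E_def norm_mult power_mult_distrib exp_double[symmetric])
  have cE: "continuous_on UNIV E" unfolding E_def by (intro continuous_intros) auto
  have meas: "v n \<in> borel_measurable lborel" "v0 \<in> borel_measurable lborel" "w \<in> borel_measurable lborel" for n
  proof -
    have "continuous_on UNIV (v n)" "continuous_on UNIV v0" "continuous_on UNIV w"
      unfolding v_def v0_def w_def
      by (intro continuous_intros continuous_on_compose2[OF ch] cg ch cE; auto)+
    then show "v n \<in> borel_measurable lborel" "v0 \<in> borel_measurable lborel" "w \<in> borel_measurable lborel"
      by (auto dest: borel_measurable_continuous_onI)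
  qed
  define H where "H z = (cmod (h z))\<^sup>2 * exp (- (norm z)\<^sup>2)" for z
  have H: "integrable lborel H" unfolding H_def by (rule fock_integrable[OF h])
  have H0: "H z \<ge> 0" for z by (simp add: H_def)
  define N where "N = (\<integral>z. H z \<partial>lborel)"
  have N: "N \<ge> 0" unfolding N_def by (rule integral_nonneg_AE) (simp add: H0)
  have scale: "of_real c *s z = c *\<^sub>R z" for c and z :: "complex^'n"
    unfolding vec_eq_iff vector_smult_component vector_scaleR_component
    by (simp add: scaleR_conv_of_real)
  have exp_sq: "(cmod (exp c * y))\<^sup>2 * exp (- t) = exp (2 * Re c - t) * (cmod y)\<^sup>2" for c y t
    by (simp add: norm_mult power_mult_distrib exp_double[symmetric] exp_diff exp_minus field_simps)
  have vH: "(cmod (v n z))\<^sup>2 \<le> exp ((norm q)\<^sup>2) * H (r n *\<^sub>R z)" for n z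
  proof -
    let ?r = "r n" and ?s = "norm z" and ?b = "norm q"
    have "Re ((1 - of_real ?r) * cinner z q) \<le> (1 - ?r) * (?s * ?b)"
      using r[of n] order_trans[OF complex_Re_le_cmod cmod_cinner_le, of z q]
      by (simp add: mult_left_mono)
    moreover have "2 * ((1 - ?r) * (?s * ?b)) - ?s\<^sup>2 \<le> ?b\<^sup>2 - ?r\<^sup>2 * ?s\<^sup>2"
    proof -
      \<comment> \<open>The difference of the two sides of the claim, regrouped into terms that are
        nonnegative for \<open>r\<close> between 0 and 1.\<close>
      have "0 \<le> (1 - ?r) * (?s - ?b)\<^sup>2 + ?r * (1 - ?r) * ?s\<^sup>2 + ?r * ?b\<^sup>2"
        using r[of n] by (intro add_nonneg_nonneg mult_nonneg_nonneg) auto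
      also have "\<dots> = ?b\<^sup>2 - ?r\<^sup>2 * ?s\<^sup>2 - (2 * ((1 - ?r) * (?s * ?b)) - ?s\<^sup>2)"
        by (simp add: power2_eq_square algebra_simps)
      finally show ?thesis by simp
    qed
    ultimately have *: "2 * Re ((1 - of_real ?r) * cinner z q) - ?s\<^sup>2 \<le> ?b\<^sup>2 - ?r\<^sup>2 * ?s\<^sup>2"
      by linarith
    have "(cmod (v n z))\<^sup>2 = exp (2 * Re ((1 - of_real ?r) * cinner z q) - ?s\<^sup>2) * (cmod (h (?r *\<^sub>R z)))\<^sup>2"
      unfolding v_def norm2E exp_sq scale ..
    also have "\<dots> \<le> exp (?b\<^sup>2 - ?r\<^sup>2 * ?s\<^sup>2) * (cmod (h (?r *\<^sub>R z)))\<^sup>2"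
      using * by (intro mult_right_mono) auto
    also have "\<dots> = exp (?b\<^sup>2) * H (?r *\<^sub>R z)"
      by (simp add: H_def exp_diff exp_minus field_simps)
    finally show ?thesis .
  qed
  \<comment> \<open>The power of 2 bounds the Jacobian factor
    \<open>1 / r n ^ DIM(complex^'n)\<close>, as \<open>r n \<ge> 1/2\<close>.\<close>
  define B where "B = exp ((norm q)\<^sup>2) * (N * 2 ^ DIM(complex^'n))"
  have Hr: "integrable lborel (\<lambda>z. H (r n *\<^sub>R z))" "(\<integral>z. H (r n *\<^sub>R z) \<partial>lborel) \<le> N * 2 ^ DIM(complex^'n)" for n
  proof -
    have r0: "r n \<noteq> 0" using r(1)[of n] by auto
    show "integrable lborel (\<lambda>z. H (r n *\<^sub>R z))" by (rule integral_lborel_scale(1)[OF H r0])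
    have "1 \<le> (2 * r n) ^ DIM(complex^'n)" using r(1)[of n] by (intro one_le_power) auto
    then have "N \<le> N * (2 * r n) ^ DIM(complex^'n)"
      using mult_left_mono[OF _ N] by fastforce
    then have "N / r n ^ DIM(complex^'n) \<le> N * 2 ^ DIM(complex^'n)"
      using r(1)[of n] by (subst pos_divide_le_eq) (auto simp: power_mult_distrib mult_ac)
    then show "(\<integral>z. H (r n *\<^sub>R z) \<partial>lborel) \<le> N * 2 ^ DIM(complex^'n)"
      unfolding integral_lborel_scale(2)[OF H r0] N_def using r(1)[of n] by simp
  qed
  have "(\<lambda>n. \<integral>z. v n z * w z \<partial>lborel) \<longlonglongrightarrow> (\<integral>z. v0 z * w z \<partial>lborel)"
  proof (rule tendsto_integral_weak_L2[OF meas, where B = B and A = "\<lambda>k. cball 0 (real k)"])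
    show "(\<lambda>n. v n z) \<longlonglongrightarrow> v0 z" for z
    proof -
      have "(\<lambda>n. r n *\<^sub>R z) \<longlonglongrightarrow> 1 *\<^sub>R z" by (intro tendsto_intros r_lim)
      then have "(\<lambda>n. h (of_real (r n) *s z)) \<longlonglongrightarrow> h (1 *s z)"
        using continuous_on_tendsto_compose[OF ch, of "\<lambda>n. r n *\<^sub>R z" z sequentially] by (simp add: scale)
      moreover have "(\<lambda>n. exp ((1 - of_real (r n)) * cinner z q)) \<longlonglongrightarrow> exp ((1 - of_real 1) * cinner z q)"
        by (intro tendsto_intros r_lim)
      ultimately have "(\<lambda>n. v n z) \<longlonglongrightarrow> exp ((1 - of_real 1) * cinner z q) * h (1 *s z) * E z"
        unfolding v_def by (intro tendsto_mult tendsto_const)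
      then show ?thesis by (simp add: v0_def)
    qed
    show "integrable lborel (\<lambda>z. (cmod (w z))\<^sup>2)"
      using fock_integrable[OF g] by (simp add: w_def norm2E)
    have int: "integrable lborel (\<lambda>z. exp ((norm q)\<^sup>2) * H (r n *\<^sub>R z))" for n
      using Hr by simp
    show v2: "integrable lborel (\<lambda>z. (cmod (v n z))\<^sup>2)" for n
      using meas(1) vH by (intro Bochner_Integration.integrable_bound[OF int[of n]]) (auto simp: H0)
    show "(\<integral>z. (cmod (v n z))\<^sup>2 \<partial>lborel) \<le> B" for n
    proof -
      have "(\<integral>z. (cmod (v n z))\<^sup>2 \<partial>lborel) \<le> (\<integral>z. exp ((norm q)\<^sup>2) * H (r n *\<^sub>R z) \<partial>lborel)"
        by (rule integral_mono[OF v2 int vH])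
      also have "\<dots> \<le> B" using Hr(2)[of n] by (simp add: B_def)
      finally show ?thesis .
    qed
    show "integrable lborel (\<lambda>z. (cmod (v0 z))\<^sup>2)"
      using H by (simp add: v0_def norm2E H_def[abs_def])
    have "N * 1 \<le> 1 * (N * 2 ^ DIM(complex^'n))"
      unfolding mult_1 by (intro mult_left_mono N one_le_power) simp
    also have "\<dots> \<le> exp ((norm q)\<^sup>2) * (N * 2 ^ DIM(complex^'n))"
      by (intro mult_right_mono mult_nonneg_nonneg N) auto
    finally have "N \<le> exp ((norm q)\<^sup>2) * (N * 2 ^ DIM(complex^'n))" by simp
    then show "(\<integral>z. (cmod (v0 z))\<^sup>2 \<partial>lborel) \<le> B"
      by (simp add: v0_def norm2E H_def[symmetric] N_def[symmetric] B_def)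
    show "cball 0 (real k) \<in> sets lborel" for k by simp
    show "\<forall>\<^sub>F k in sequentially. z \<in> cball 0 (real k)" for z :: "complex^'n"
      using eventually_ge_at_top[of "nat \<lceil>norm z\<rceil>"] by eventually_elim (auto; linarith)
    \<comment> \<open>On a fixed ball the twist and the dilates of \<open>h\<close> are bounded
      uniformly in \<open>n\<close>, so a multiple of \<open>cmod (g z)\<close> times the Gaussian
      dominates.\<close>
    show "\<exists>G. integrable lborel G \<and> (\<forall>n. \<forall>z\<in>cball 0 (real k). cmod (v n z * w z) \<le> G z)" for k
    proof (intro exI conjI allI ballI)
      let ?c = "exp (real k * norm q) * (C * exp ((real k)\<^sup>2 / 2))"
      show "integrable lborel (\<lambda>z. ?c * (cmod (g z) * exp (0 * norm z + 0 * (norm z)\<^sup>2 - (norm z)\<^sup>2)))"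
        by (intro integrable_mult_right fock_integrable_exp g) simp
      fix n and z :: "complex^'n" assume "z \<in> cball 0 (real k)"
      then have z: "norm z \<le> real k" by simp
      have "(1 - r n) * Re (cinner z q) \<le> 1 * (real k * norm q)"
      proof (cases "Re (cinner z q) \<ge> 0")
        case True
        then show ?thesis
          using r[of n] order_trans[OF complex_Re_le_cmod order_trans[OF cmod_cinner_le mult_right_mono[OF z]]]
          by (intro mult_mono) auto
      next
        case False
        then show ?thesis using r[of n]
          by (intro order_trans[OF mult_nonneg_nonpos]) auto
      qed
      then have 1: "cmod (exp ((1 - of_real (r n)) * cinner z q)) \<le> exp (real k * norm q)"
        by simp
      have "norm (of_real (r n) *s z) \<le> 1 * real k"
        unfolding norm_scale_vec using r[of n] z by (intro mult_mono) auto
      then have "(norm (of_real (r n) *s z))\<^sup>2 \<le> (real k)\<^sup>2" by (intro power_mono) auto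
      then have 2: "cmod (h (of_real (r n) *s z)) \<le> C * exp ((real k)\<^sup>2 / 2)"
        using C(1) by (intro order_trans[OF C(2)] mult_left_mono) auto
      have "v n z * w z = exp ((1 - of_real (r n)) * cinner z q) * h (of_real (r n) *s z) * cnj (g z) *
          complex_of_real (exp (- (norm z)\<^sup>2))"
        unfolding v_def w_def by (rule EE)
      then show "cmod (v n z * w z) \<le> ?c * (cmod (g z) * exp (0 * norm z + 0 * (norm z)\<^sup>2 - (norm z)\<^sup>2))"
        using mult_right_mono[OF mult_mono[OF 1 2], of "cmod (g z) * exp (- (norm z)\<^sup>2)"] C(1)
        by (simp add: norm_mult mult_ac)
    qed
  qed
  moreover have "(\<integral>z. v n z * w z \<partial>lborel) = twisted_dilation q h g (of_real (r n))" for n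
    by (simp add: twisted_dilation_def v_def w_def EE)
  moreover have "(\<integral>z. v0 z * w z \<partial>lborel) = pi ^ CARD('n) * fock_inner h g"
    by (simp add: v0_def w_def EE fock_inner_def)
  ultimately show ?thesis by simp
qed

section \<open>Real symmetric weighted composition operators\<close>

lemma cinner_matrix_adj:
  assumes "cmat_adj Q = Q"
  shows "cinner (Q *v z) w = cinner z (Q *v w)"
proof -
  have Q: "Q $ i $ j = cnj (Q $ j $ i)" for i j
  proof -
    have "cmat_adj Q $ i $ j = cnj (Q $ j $ i)" by (simp add: cmat_adj_def)
    then show ?thesis by (simp only: assms)
  qed
  have "cinner (Q *v z) w = (\<Sum>i\<in>UNIV. \<Sum>j\<in>UNIV. Q $ i $ j * z $ j * cnj (w $ i))"
    by (simp add: cinner_def matrix_vector_mult_def sum_distrib_right)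
  also have "\<dots> = (\<Sum>j\<in>UNIV. \<Sum>i\<in>UNIV. Q $ i $ j * z $ j * cnj (w $ i))"
    by (rule sum.swap)
  also have "\<dots> = (\<Sum>j\<in>UNIV. \<Sum>i\<in>UNIV. z $ j * cnj (Q $ j $ i * w $ i))"
    by (intro sum.cong refl) (subst Q, simp add: mult_ac)
  also have "\<dots> = cinner z (Q *v w)"
    by (simp add: cinner_def matrix_vector_mult_def sum_distrib_left)
  finally show ?thesis .
qed

lemma matrix_vector_scale: "Q *v (c *s z) = c *s (Q *v (z::complex^'n))"
  by (simp add: vec_eq_iff matrix_vector_mult_def sum_distrib_left mult_ac)

lemma matrix_vector_bounded:
  fixes Q :: "complex^'n^'n"
  obtains K where "K > 0" "\<And>z. norm (Q *v z) \<le> K * norm z"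
proof -
  have "linear ((*v) Q)"
  proof (rule linearI)
    show "Q *v (x + y) = Q *v x + Q *v y" for x y by (rule matrix_vector_right_distrib)
    show "Q *v (c *\<^sub>R x) = c *\<^sub>R (Q *v x)" for c x
      unfolding vec_eq_iff by (simp add: matrix_vector_mult_def scaleR_sum_right)
  qed
  from linear_bounded_pos[OF this] that show ?thesis by blast
qed

lemma integrable_pair_mult:
  fixes P :: "'a::euclidean_space \<Rightarrow> real" and R :: "'b::euclidean_space \<Rightarrow> real"
  assumes P: "integrable lborel P" and R: "integrable lborel R"
  shows "integrable (lborel \<Otimes>\<^sub>M lborel) (\<lambda>(x, y). P x * R y)"
proof (rule lborel_pair.Fubini_integrable)
  have [measurable]: "P \<in> borel_measurable lborel" "R \<in> borel_measurable lborel" using P R by auto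
  show "(\<lambda>(x, y). P x * R y) \<in> borel_measurable (lborel \<Otimes>\<^sub>M lborel)" by measurable
  show "integrable lborel (\<lambda>x. \<integral>y. norm (case (x, y) of (x, y) \<Rightarrow> P x * R y) \<partial>lborel)"
    using P by (simp add: abs_mult)
  show "AE x in lborel. integrable lborel (\<lambda>y. case (x, y) of (x, y) \<Rightarrow> P x * R y)"
    using R by simp
qed

text \<open>Let \<open>T\<^sub>r f z = \<theta> * exp (cinner z q) * f (r Q z + q)\<close>. Writing
  \<open>f (r Q z + q)\<close> by the reproducing formula turns the inner product of
  \<open>T\<^sub>r f\<close> with \<open>g\<close> into a double integral. This is its integrand,
  without \<open>\<theta>\<close> and the powers of \<open>pi\<close>.\<close>

definition affine_form ::
  "complex^'n^'n \<Rightarrow> complex^'n \<Rightarrow> real \<Rightarrow> (complex^'n \<Rightarrow> complex) \<Rightarrow> (complex^'n \<Rightarrow> complex) \<Rightarrow>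
    complex^'n \<Rightarrow> complex^'n \<Rightarrow> complex" where
  "affine_form Q q r f g z w = f w * cnj (g z) * exp (cinner z q + of_real r * cinner (Q *v z) w + cinner q w) *
      complex_of_real (exp (- (norm w)\<^sup>2)) * complex_of_real (exp (- (norm z)\<^sup>2))"

text \<open>Symmetry of the operator at the level of integrands: for Hermitian \<open>Q\<close> and
  real \<open>r\<close>, conjugation exchanges the two outer terms of the exponent and moves
  \<open>Q\<close> to the other argument in the middle term.\<close>

lemma cnj_affine_form:
  assumes "cmat_adj Q = Q"
  shows "cnj (affine_form Q q r g f w z) = affine_form Q q r f g z w"
  by (simp add: affine_form_def exp_cnj cnj_cinner cinner_matrix_adj[OF assms] add_ac mult_ac)

text \<open>When \<open>r * K \<le> 1/2\<close>, the mixed term of the exponent is at most a quarter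
  of \<open>(norm z)\<^sup>2 + (norm w)\<^sup>2\<close>. The integrand is then dominated by a
  product of one function of \<open>z\<close> and one of \<open>w\<close>, each integrable because
  \<open>1/4 < 1/2\<close>.\<close>

lemma affine_form_integrable:
  assumes f: "f \<in> fock" and g: "g \<in> fock" and K: "\<And>z. norm (Q *v z) \<le> K * norm z"
    and r: "0 \<le> r" "r * K \<le> 1/2"
  shows "integrable (lborel \<Otimes>\<^sub>M lborel) (\<lambda>(z, w). affine_form Q q r f g z w)"
proof (rule Bochner_Integration.integrable_bound)
  define B where "B f z = cmod (f z) * exp (norm q * norm z + 1/4 * (norm z)\<^sup>2 - (norm z)\<^sup>2)"
    for f :: "complex^'a \<Rightarrow> complex" and z
  show "integrable (lborel \<Otimes>\<^sub>M lborel) (\<lambda>(z, w). B g z * B f w)"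
    unfolding B_def by (intro integrable_pair_mult fock_integrable_exp f g) auto
  have cont: "continuous_on UNIV (\<lambda>(z, w). affine_form Q q r f g z w)"
  proof -
    have "continuous_on UNIV (\<lambda>p. Q *v fst p)" for Q :: "complex^'a^'a"
      unfolding matrix_vector_mult_def by (intro continuous_intros)
    then show ?thesis
      unfolding affine_form_def split_def
      by (intro continuous_intros continuous_on_compose2[OF entire_fun_continuous[OF fock_entire[OF f]]]
          continuous_on_compose2[OF entire_fun_continuous[OF fock_entire[OF g]]]) auto
  qed
  then show "(\<lambda>(z, w). affine_form Q q r f g z w) \<in> borel_measurable (lborel \<Otimes>\<^sub>M lborel)"
    unfolding lborel_prod using borel_measurable_continuous_onI[OF cont] by simp
  have "cmod (affine_form Q q r f g z w) \<le> B g z * B f w" for z w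
  proof -
    have "cmod (of_real r * cinner (Q *v z) w) \<le> r * (K * norm z * norm w)"
      unfolding norm_mult using r order_trans[OF cmod_cinner_le mult_right_mono[OF K]]
      by (auto intro: mult_left_mono)
    also have "\<dots> \<le> 1/2 * (norm z * norm w)"
      using mult_right_mono[OF r(2), of "norm z * norm w"] by (simp add: mult_ac)
    also have "\<dots> \<le> 1/4 * (norm z)\<^sup>2 + 1/4 * (norm w)\<^sup>2"
      using sum_squares_bound[of "norm z" "norm w"] by simp
    finally have "Re (of_real r * cinner (Q *v z) w) \<le> 1/4 * (norm z)\<^sup>2 + 1/4 * (norm w)\<^sup>2"
      using complex_Re_le_cmod order_trans by blast
    moreover have "Re (cinner z q) \<le> norm q * norm z" "Re (cinner q w) \<le> norm q * norm w"
      using order_trans[OF complex_Re_le_cmod cmod_cinner_le] by (metis mult.commute)+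
    ultimately have "Re (cinner z q + of_real r * cinner (Q *v z) w + cinner q w) - (norm w)\<^sup>2 - (norm z)\<^sup>2
        \<le> (norm q * norm z + 1/4 * (norm z)\<^sup>2 - (norm z)\<^sup>2) + (norm q * norm w + 1/4 * (norm w)\<^sup>2 - (norm w)\<^sup>2)"
      (is "?a \<le> ?b + ?c") by simp
    then have "exp ?a \<le> exp ?b * exp ?c" unfolding exp_add[symmetric] by simp
    then have "(cmod (f w) * cmod (g z)) * exp ?a \<le> (cmod (f w) * cmod (g z)) * (exp ?b * exp ?c)"
      by (intro mult_left_mono) auto
    moreover have "cmod (affine_form Q q r f g z w) = (cmod (f w) * cmod (g z)) * exp ?a"
      by (simp add: affine_form_def norm_mult exp_diff exp_minus divide_inverse mult.assoc norm_inverse)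
    ultimately show ?thesis by (simp add: B_def mult_ac)
  qed
  then show "AE p in lborel \<Otimes>\<^sub>M lborel. norm (case p of (z, w) \<Rightarrow> affine_form Q q r f g z w)
      \<le> norm (case p of (z, w) \<Rightarrow> B g z * B f w)"
    by (intro AE_I2) (auto intro: order_trans[OF _ abs_ge_self])
qed

text \<open>The inner integral is the reproducing formula at the point \<open>r Q z + q\<close>. On
  the other side the twist restores the part of \<open>exp (cinner z q)\<close> that dilation
  removes.\<close>

lemma twisted_dilation_eq_affine_form:
  fixes f g :: "complex^'n \<Rightarrow> complex"
  assumes f: "f \<in> fock"
  shows "pi ^ CARD('n) * twisted_dilation q (\<lambda>z. \<theta> * exp (cinner z q) * f (Q *v z + q)) g (of_real r)
    = \<theta> * (\<integral>z. (\<integral>w. affine_form Q q r f g z w \<partial>lborel) \<partial>lborel)"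
proof -
  define S where "S z = exp (cinner z q) * f (of_real r *s (Q *v z) + q) * cnj (g z) * complex_of_real (exp (- (norm z)\<^sup>2))" for z
  have "(\<integral>w. affine_form Q q r f g z w \<partial>lborel) = pi ^ CARD('n) * S z" for z
  proof -
    have "(\<integral>w. affine_form Q q r f g z w \<partial>lborel)
      = (\<integral>w. exp (cinner z q) * cnj (g z) * complex_of_real (exp (- (norm z)\<^sup>2)) *
          (f w * exp (cinner (of_real r *s (Q *v z) + q) w) * complex_of_real (exp (- (norm w)\<^sup>2))) \<partial>lborel)"
      by (simp add: affine_form_def cinner_add_left cinner_scale_left exp_add mult_ac)
    also have "\<dots> = exp (cinner z q) * cnj (g z) * complex_of_real (exp (- (norm z)\<^sup>2)) *
        (pi ^ CARD('n) * f (of_real r *s (Q *v z) + q))"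
      by (subst integral_mult_right_zero) (simp only: fock_reproducing[OF f])
    finally show ?thesis by (simp add: S_def mult_ac)
  qed
  then have 1: "(\<integral>z. (\<integral>w. affine_form Q q r f g z w \<partial>lborel) \<partial>lborel) = pi ^ CARD('n) * (\<integral>z. S z \<partial>lborel)"
    by simp
  have "exp ((1 - of_real r) * cinner z q) *
      (\<theta> * exp (cinner (of_real r *s z) q) * f (Q *v (of_real r *s z) + q)) * cnj (g z) *
      complex_of_real (exp (- (norm z)\<^sup>2)) = \<theta> * S z" for z
  proof -
    have "exp (cinner z q) = exp ((1 - of_real r) * cinner z q) * exp (of_real r * cinner z q)"
      by (simp add: exp_add[symmetric] algebra_simps)
    then show ?thesis
      unfolding S_def cinner_scale_left matrix_vector_scale by (simp only: mult_ac)
  qed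
  then have "twisted_dilation q (\<lambda>z. \<theta> * exp (cinner z q) * f (Q *v z + q)) g (of_real r) = \<theta> * (\<integral>z. S z \<partial>lborel)"
    by (simp only: twisted_dilation_def integral_mult_right_zero)
  with 1 show ?thesis by simp
qed

section \<open>Self-adjointness on the maximal domain\<close>

text \<open>Both sides are limits, as \<open>r\<close> tends to 1, of functions holomorphic in the
  unit disc. These agree for small positive \<open>r\<close>, where Fubini is available, and hence
  on the whole disc.\<close>

lemma affine_op_symmetric:
  fixes f g :: "complex^'n \<Rightarrow> complex" and q :: "complex^'n"
  assumes Q: "cmat_adj Q = Q" and \<theta>: "\<theta> \<in> \<real>"
  defines "T \<equiv> \<lambda>f z. \<theta> * exp (cinner z q) * f (Q *v z + q)"
  assumes f: "f \<in> fock" and g: "g \<in> fock" and Tf: "T f \<in> fock" and Tg: "T g \<in> fock"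
  shows "fock_inner (T f) g = fock_inner f (T g)"
proof -
  obtain K where K: "K > 0" "\<And>z. norm (Q *v z) \<le> K * norm z" using matrix_vector_bounded by blast
  \<comment> \<open>Conjugating the values alone would make the second function antiholomorphic.
    Conjugating the argument as well makes \<open>?B\<close> holomorphic and changes nothing for
    real \<open>r\<close>.\<close>
  let ?A = "twisted_dilation q (T f) g" and ?B = "cnj \<circ> twisted_dilation q (T g) f \<circ> cnj"
  \<comment> \<open>For \<open>s\<close> in this interval \<open>s * K < 1/2\<close>, as absolute
    integrability of the double integral requires, and \<open>U\<close> lies in the disc.\<close>
  define U where "U = complex_of_real ` {0<..<min 1 (1 / (2 * K))}"
  have "?B holomorphic_on ball 0 1"
  proof -
    have "cnj ` ball 0 1 = ball 0 1"
      by (auto intro!: image_eqI[of _ cnj "cnj _"])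
    then show ?thesis
      using twisted_dilation_holomorphic[OF Tg f, of q]
      by (intro holomorphic_on_compose_cnj_cnj) auto
  qed
  then have hol: "(\<lambda>r. ?A r - ?B r) holomorphic_on ball 0 1"
    by (intro holomorphic_intros twisted_dilation_holomorphic Tf g)
  have small: "?A r - ?B r = 0" if r: "r \<in> U" for r
  proof -
    obtain s where s: "r = of_real s" "s \<in> {0<..<min 1 (1 / (2 * K))}" using r unfolding U_def by blast
    then have s': "0 < s" "s < 1 / (2 * K)" by simp_all
    then have sK: "s * K \<le> 1/2" using K(1) by (simp add: field_simps)
    have "(\<integral>z. (\<integral>w. affine_form Q q s f g z w \<partial>lborel) \<partial>lborel)
        = (\<integral>w. (\<integral>z. affine_form Q q s f g z w \<partial>lborel) \<partial>lborel)"
      by (rule lborel_pair.Fubini_integral[symmetric], rule affine_form_integrable[OF f g K(2) _ sK])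
        (use s' in simp)
    also have "\<dots> = (\<integral>w. (\<integral>z. cnj (affine_form Q q s g f w z) \<partial>lborel) \<partial>lborel)"
      by (simp only: cnj_affine_form[OF Q])
    also have "\<dots> = cnj (\<integral>w. (\<integral>z. affine_form Q q s g f w z \<partial>lborel) \<partial>lborel)"
      by (simp only: Bochner_Integration.integral_cnj)
    finally have "\<theta> * (\<integral>z. (\<integral>w. affine_form Q q s f g z w \<partial>lborel) \<partial>lborel)
      = cnj (\<theta> * (\<integral>w. (\<integral>z. affine_form Q q s g f w z \<partial>lborel) \<partial>lborel))"
      using \<theta> by (simp add: Reals_cnj_iff)
    then have "pi ^ CARD('n) * ?A (of_real s) = cnj (pi ^ CARD('n) * twisted_dilation q (T g) f (of_real s))"
      unfolding T_def twisted_dilation_eq_affine_form[OF f] twisted_dilation_eq_affine_form[OF g] .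
    then show ?thesis by (simp add: s)
  qed
  \<comment> \<open>Identity theorem: the zeros in \<open>U\<close> accumulate at 0, an interior
    point of the disc.\<close>
  have zero: "?A r - ?B r = 0" if "r \<in> ball 0 1" for r
  proof (rule analytic_continuation[OF hol open_ball connected_ball _ _ _ small that])
    show "U \<subseteq> ball 0 1" by (auto simp: U_def)
    show "(0::complex) \<in> ball 0 1" by simp
    show "0 islimpt U"
      unfolding islimpt_approachable
    proof (intro allI impI)
      fix e :: real assume e: "e > 0"
      define t where "t = min e (min 1 (1 / (2 * K))) / 2"
      have t: "0 < t" "t < e" "t < min 1 (1 / (2 * K))"
        using e K(1) by (auto simp: t_def min_def field_simps)
      then show "\<exists>x'\<in>U. x' \<noteq> 0 \<and> dist x' 0 < e"
        unfolding U_def by (intro bexI[of _ "of_real t"]) auto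
    qed
  qed
  let ?r = "\<lambda>n. of_real (1 - 1 / (real n + 2))"
  have "?A (?r n) = cnj (twisted_dilation q (T g) f (?r n))" for n
    using zero[of "?r n"] by (simp add: field_simps norm_divide del: of_real_diff of_real_divide of_real_add)
  then have "(\<lambda>n. ?A (?r n)) \<longlonglongrightarrow> cnj (pi ^ CARD('n) * fock_inner (T g) f)"
    by (simp only:) (intro tendsto_cnj twisted_dilation_tendsto Tg f)
  from LIMSEQ_unique[OF this twisted_dilation_tendsto[OF Tf g]] show ?thesis
    by (simp add: cnj_fock_inner)
qed

text \<open>One inclusion of graphs is \<open>affine_op_symmetric\<close>. For the other, all
  kernels lie in the domain, and testing the adjoint relation against them gives
  \<open>h = E_op \<psi> \<phi> g\<close> pointwise; as \<open>h\<close> is in the Fock space,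
  \<open>g\<close> is in the maximal domain.\<close>

lemma real_symmetric_affine_op:
  fixes \<psi> :: "complex^'n \<Rightarrow> complex"
  assumes Q: "cmat_adj Q = Q" and \<theta>: "\<theta> \<in> \<real>"
    and \<psi>: "\<And>z. \<psi> z = \<theta> * exp (cinner z q)" and \<phi>: "\<And>z. \<phi> z = Q *v z + q"
  shows "real_symmetric_op (dom_max \<psi> \<phi>) (E_op \<psi> \<phi>)"
proof -
  have E: "E_op \<psi> \<phi> f = (\<lambda>z. \<theta> * exp (cinner z q) * f (Q *v z + q))" for f
    by (simp add: E_op_def \<psi> \<phi>)
  have sub: "(f, E_op \<psi> \<phi> f) \<in> adj_graph (dom_max \<psi> \<phi>) (E_op \<psi> \<phi>)" if "f \<in> dom_max \<psi> \<phi>" for f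
    using that affine_op_symmetric[OF Q \<theta>, of _ f q] by (auto simp: adj_graph_def dom_max_def E)
  have sup: "g \<in> dom_max \<psi> \<phi> \<and> h = E_op \<psi> \<phi> g" if "(g, h) \<in> adj_graph (dom_max \<psi> \<phi>) (E_op \<psi> \<phi>)" for g h
  proof -
    have g: "g \<in> fock" and h: "h \<in> fock"
      and adj: "\<And>f. f \<in> dom_max \<psi> \<phi> \<Longrightarrow> fock_inner (E_op \<psi> \<phi> f) g = fock_inner f h"
      using that by (auto simp: adj_graph_def)
    have "h z = E_op \<psi> \<phi> g z" for z
    proof -
      \<comment> \<open>The operator maps a kernel to a multiple of another kernel: \<open>Q\<close>
        being Hermitian moves it from \<open>u\<close> to \<open>z\<close> in the exponent.\<close>
      have EK: "E_op \<psi> \<phi> (fock_kernel z) = (\<lambda>u. \<theta> * exp (cinner q z) * fock_kernel (\<phi> z) u)"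
        by (simp add: fun_eq_iff E \<phi> fock_kernel_def cinner_add_left cinner_add_right exp_add cinner_matrix_adj[OF Q])
      then have "fock_kernel z \<in> dom_max \<psi> \<phi>"
        by (simp add: dom_max_def fock_kernel_in_fock fock_scale)
      from adj[OF this] have "\<theta> * exp (cinner q z) * fock_inner (fock_kernel (\<phi> z)) g = fock_inner (fock_kernel z) h"
        by (simp only: EK fock_inner_scale_left)
      then have "cnj (h z) = \<theta> * exp (cinner q z) * cnj (g (\<phi> z))"
        by (metis cnj_fock_inner fock_inner_kernel g h)
      then have "h z = cnj (\<theta> * exp (cinner q z) * cnj (g (\<phi> z)))" by (metis complex_cnj_cnj)
      also have "\<dots> = E_op \<psi> \<phi> g z"
        using \<theta> by (simp add: E \<phi> exp_cnj cnj_cinner Reals_cnj_iff)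
      finally show ?thesis .
    qed
    then have "h = E_op \<psi> \<phi> g" by blast
    with g h show ?thesis by (simp add: dom_max_def)
  qed
  show ?thesis
    unfolding real_symmetric_op_def op_graph_def using sub sup by auto
qed

section \<open>Necessity of the affine form\<close>

text \<open>The values of \<open>g\<close> are integer multiples of \<open>2 * pi * \<i>\<close>.
  Distinct ones are at least \<open>2 * pi\<close> apart, so a continuous path through them is
  constant.\<close>

lemma exp_eq_1_path:
  fixes g :: "real \<Rightarrow> complex"
  assumes cont: "continuous_on {0..1} g" and g: "\<And>t. t \<in> {0..1} \<Longrightarrow> exp (g t) = 1" and g0: "g 0 = 0"
  shows "g 1 = 0"
proof -
  have "g constant_on {0..1}"
  proof (rule continuous_discrete_range_constant[OF _ cont])
    show "\<exists>e>0. \<forall>y. y \<in> {0..1} \<and> g y \<noteq> g x \<longrightarrow> e \<le> norm (g y - g x)" if x: "x \<in> {0..1}" for x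
    proof (intro exI[of _ "2 * pi"] conjI allI impI)
      fix y assume y: "y \<in> {0..1} \<and> g y \<noteq> g x"
      have "exp (g y - g x) = 1" using g[of y] g[of x] x y by (simp add: exp_diff)
      then obtain n :: int where n: "Re (g y - g x) = 0" "Im (g y - g x) = of_int (2 * n) * pi"
        by (auto simp: exp_eq_1)
      with y have "n \<noteq> 0" by (auto simp: complex_eq_iff)
      then have "1 \<le> \<bar>real_of_int n\<bar>" by linarith
      then have "2 * pi \<le> \<bar>Im (g y - g x)\<bar>" unfolding n(2) by (simp add: abs_mult)
      then show "2 * pi \<le> norm (g y - g x)" using abs_Im_le_cmod order_trans by blast
    qed simp
  qed simp
  then show ?thesis using g0 by (auto simp: constant_on_def)
qed

text \<open>The adjoint acts on kernels as stated in \<open>kernel\<close> whatever \<open>D\<close>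
  is, since every \<open>f\<close> in \<open>D\<close> and its image are reproduced pointwise.
  Symmetry then forces the kernels into \<open>D\<close>, so no density or maximality of
  \<open>D\<close> has to be assumed.\<close>

lemma real_symmetric_op_imp_affine:
  fixes \<psi> :: "complex^'n \<Rightarrow> complex"
  assumes \<psi>0: "\<psi> \<noteq> (\<lambda>_. 0)" and \<phi>: "holo_self_map \<phi>"
    and D: "D \<subseteq> dom_max \<psi> \<phi>" and sym: "real_symmetric_op D (E_op \<psi> \<phi>)"
  shows "\<exists>Q q \<theta>. cmat_adj Q = Q \<and> \<theta> \<in> \<real> \<and>
         (\<forall>z. \<psi> z = \<theta> * exp (cinner z q)) \<and> (\<forall>z. \<phi> z = Q *v z + q)"
proof -
  have kernel: "\<psi> u * exp (cinner (\<phi> u) z) = cnj (\<psi> z) * exp (cinner u (\<phi> z))" for u z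
  proof -
    have "(fock_kernel z, \<lambda>u. cnj (\<psi> z) * fock_kernel (\<phi> z) u) \<in> adj_graph D (E_op \<psi> \<phi>)"
      unfolding adj_graph_def
    proof (safe intro!: fock_scale fock_kernel_in_fock)
      fix f assume "f \<in> D"
      with D have "f \<in> fock" "E_op \<psi> \<phi> f \<in> fock" by (auto simp: dom_max_def)
      then show "fock_inner (E_op \<psi> \<phi> f) (fock_kernel z) = fock_inner f (\<lambda>u. cnj (\<psi> z) * fock_kernel (\<phi> z) u)"
        by (simp add: fock_inner_kernel fock_inner_scale_right) (simp add: E_op_def)
    qed
    then have "(fock_kernel z, \<lambda>u. cnj (\<psi> z) * fock_kernel (\<phi> z) u) \<in> op_graph D (E_op \<psi> \<phi>)"
      using sym by (simp add: real_symmetric_op_def)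
    then have "E_op \<psi> \<phi> (fock_kernel z) = (\<lambda>u. cnj (\<psi> z) * fock_kernel (\<phi> z) u)"
      by (auto simp: op_graph_def)
    then have "E_op \<psi> \<phi> (fock_kernel z) u = cnj (\<psi> z) * fock_kernel (\<phi> z) u" by simp
    then show ?thesis by (simp add: E_op_def fock_kernel_def)
  qed
  define \<theta> q where "\<theta> = \<psi> 0" and "q = \<phi> 0"
  have \<theta>: "cnj \<theta> = \<theta>" using kernel[of 0 0] by (simp add: \<theta>_def)
  have \<psi>: "\<psi> u = \<theta> * exp (cinner u q)" for u
    using kernel[of u 0] \<theta> by (simp add: \<theta>_def q_def)
  have "\<theta> \<noteq> 0" using \<psi>0 \<psi> by (auto simp: fun_eq_iff)
  have contphi: "continuous_on UNIV (\<lambda>z. \<phi> z $ i)" for i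
    using \<phi> unfolding holo_self_map_def by (blast intro: entire_fun_continuous)
  define a where "a u = \<phi> u - q" for u
  have a: "cinner (a u) z = cinner u (a z)" for u z
  proof -
    \<comment> \<open>The difference of the exponents after cancelling \<open>\<theta>\<close>. It
      equals \<open>cinner (a u) z - cinner u (a z)\<close> and vanishes at \<open>u = 0\<close>, so
      following it along the segment from 0 to \<open>u\<close> removes the ambiguity of the
      logarithm.\<close>
    define \<delta> where "\<delta> u = cinner u q + cinner (\<phi> u) z - cinner q z - cinner u (\<phi> z)" for u
    have "exp (\<delta> u) = 1" for u
    proof -
      have "\<theta> * (exp (cinner u q) * exp (cinner (\<phi> u) z)) = \<theta> * (exp (cinner q z) * exp (cinner u (\<phi> z)))"
        using kernel[of u z] \<theta> by (simp add: \<psi> exp_cnj cnj_cinner mult.assoc)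
      with \<open>\<theta> \<noteq> 0\<close> show ?thesis by (simp add: \<delta>_def exp_add exp_diff)
    qed
    moreover have "continuous_on {0..1} (\<lambda>t. \<delta> (of_real t *s u))"
      unfolding \<delta>_def cinner_def
      by (intro continuous_intros continuous_on_compose2[OF contphi]) auto
    ultimately have "\<delta> (of_real 1 *s u) = 0"
      by (intro exp_eq_1_path[of "\<lambda>t. \<delta> (of_real t *s u)"]) (auto simp: \<delta>_def q_def)
    moreover have diff: "cinner (x - y) w = cinner x w - cinner y w" "cinner w (x - y) = cinner w x - cinner w y"
      for x y w :: "complex^'n"
      by (simp_all add: cinner_def algebra_simps sum_subtractf)
    ultimately show ?thesis by (simp add: \<delta>_def a_def diff del: diff_eq_eq) (simp add: algebra_simps)
  qed
  have axis: "cinner x (axis j 1) = x $ j" for x :: "complex^'n" and j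
    by (simp add: cinner_def axis_def if_distrib[of cnj] if_distrib[of "(*) _"] cong: if_cong)
  \<comment> \<open>Row \<open>j\<close> is read off from
    \<open>a u $ j = cinner u (a (axis j 1))\<close>. The right-hand side is linear in
    \<open>u\<close>, so linearity of \<open>a\<close> comes with the formula.\<close>
  define Q where "Q = (\<chi> j k. cnj (a (axis j 1) $ k))"
  have herm: "a (axis j 1) $ k = cnj (a (axis k 1) $ j)" for j k
    using a[of "axis j 1" "axis k 1"] cnj_cinner[of "a (axis k 1)" "axis j 1"] by (simp add: axis)
  have "cmat_adj Q = Q" by (auto simp: cmat_adj_def Q_def vec_eq_iff intro: herm)
  moreover have "\<phi> u = Q *v u + q" for u
  proof -
    have "a u $ j = (Q *v u) $ j" for j
    proof -
      have "a u $ j = cinner u (a (axis j 1))" by (simp only: axis flip: a)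
      also have "\<dots> = (Q *v u) $ j" by (simp add: Q_def matrix_vector_mult_def cinner_def mult.commute)
      finally show ?thesis .
    qed
    then show ?thesis by (simp add: vec_eq_iff a_def diff_eq_eq)
  qed
  ultimately show ?thesis using \<psi> \<theta> by (auto simp: Reals_cnj_iff)
qed

text \<open>Self-adjoint operators have no proper self-adjoint extension: once the symbols have the
  affine form, the maximal operator is self-adjoint and extends the given one, and passing to
  adjoints reverses this inclusion.\<close>

lemma real_symmetric_op_iff:
  fixes \<psi> :: "complex^'n \<Rightarrow> complex"
  assumes "\<psi> \<noteq> (\<lambda>_. 0)" and "holo_self_map \<phi>" and D: "D \<subseteq> dom_max \<psi> \<phi>"
  shows "real_symmetric_op D (E_op \<psi> \<phi>) \<longleftrightarrow> D = dom_max \<psi> \<phi> \<and>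
    (\<exists>Q q \<theta>. cmat_adj Q = Q \<and> \<theta> \<in> \<real> \<and>
       (\<forall>z. \<psi> z = \<theta> * exp (cinner z q)) \<and> (\<forall>z. \<phi> z = Q *v z + q))"
    (is "_ \<longleftrightarrow> _ \<and> ?form")
proof
  assume sym: "real_symmetric_op D (E_op \<psi> \<phi>)"
  have form: ?form by (rule real_symmetric_op_imp_affine[OF assms sym])
  then have "real_symmetric_op (dom_max \<psi> \<phi>) (E_op \<psi> \<phi>)" using real_symmetric_affine_op by blast
  then have "op_graph (dom_max \<psi> \<phi>) (E_op \<psi> \<phi>) = adj_graph (dom_max \<psi> \<phi>) (E_op \<psi> \<phi>)"
    by (simp add: real_symmetric_op_def)
  also have "\<dots> \<subseteq> adj_graph D (E_op \<psi> \<phi>)" using D by (auto simp: adj_graph_def)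
  also have "\<dots> = op_graph D (E_op \<psi> \<phi>)" using sym by (simp add: real_symmetric_op_def)
  finally have "dom_max \<psi> \<phi> \<subseteq> D" by (auto simp: op_graph_def)
  with D form show "D = dom_max \<psi> \<phi> \<and> ?form" by blast
next
  assume "D = dom_max \<psi> \<phi> \<and> ?form"
  then show "real_symmetric_op D (E_op \<psi> \<phi>)" using real_symmetric_affine_op by blast
qed

section \<open>Reduction of the skew case to the real one\<close>

text \<open>The adjoint of \<open>\<i> T\<close> is \<open>- \<i> T\<^sup>*\<close>, hence
  \<open>T = - T\<^sup>*\<close> says that \<open>\<i> T\<close> is self-adjoint. On graphs this is
  the map \<open>m\<close>, whose injectivity lets the equality of graphs be transported both
  ways.\<close>

lemma skew_real_symmetric_op_iff_real:
  fixes \<psi> :: "complex^'n \<Rightarrow> complex"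
  shows "skew_real_symmetric_op D (E_op \<psi> \<phi>) \<longleftrightarrow> real_symmetric_op D (E_op (\<lambda>z. \<i> * \<psi> z) \<phi>)"
proof -
  define m where "m = (\<lambda>(f :: complex^'n \<Rightarrow> complex, k :: complex^'n \<Rightarrow> complex). (f, \<lambda>z. \<i> * k z))"
  have "inj m"
    by (rule injI) (auto simp: m_def fun_eq_iff)
  have Ei: "E_op (\<lambda>z. \<i> * \<psi> z) \<phi> f = (\<lambda>z. \<i> * E_op \<psi> \<phi> f z)" for f
    by (simp add: E_op_def mult.assoc)
  have graph: "op_graph D (E_op (\<lambda>z. \<i> * \<psi> z) \<phi>) = m ` op_graph D (E_op \<psi> \<phi>)"
    by (auto simp: op_graph_def m_def Ei)
  have adj: "adj_graph D (E_op (\<lambda>z. \<i> * \<psi> z) \<phi>) = m ` {(g, - h) | g h. (g, h) \<in> adj_graph D (E_op \<psi> \<phi>)}"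
  proof (intro equalityI subsetI)
    fix p assume p: "p \<in> adj_graph D (E_op (\<lambda>z. \<i> * \<psi> z) \<phi>)"
    obtain g h where gh: "p = (g, h)" by (cases p)
    have "(g, \<lambda>z. \<i> * h z) \<in> adj_graph D (E_op \<psi> \<phi>)"
    proof -
      have "fock_inner (E_op \<psi> \<phi> f) g = fock_inner f (\<lambda>z. \<i> * h z)" if "f \<in> D" for f
      proof -
        have "\<i> * fock_inner (E_op \<psi> \<phi> f) g = fock_inner f h"
          using p that unfolding gh adj_graph_def Ei fock_inner_scale_left by blast
        then have "- \<i> * (\<i> * fock_inner (E_op \<psi> \<phi> f) g) = - \<i> * fock_inner f h" by (simp only:)
        then show ?thesis by (simp add: fock_inner_scale_right)
      qed
      with p show ?thesis by (auto simp: gh adj_graph_def intro: fock_scale)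
    qed
    moreover have "p = m (g, - (\<lambda>z. \<i> * h z))" by (simp add: gh m_def fun_eq_iff)
    ultimately show "p \<in> m ` {(g, - h) | g h. (g, h) \<in> adj_graph D (E_op \<psi> \<phi>)}" by blast
  next
    fix p assume "p \<in> m ` {(g, - h) | g h. (g, h) \<in> adj_graph D (E_op \<psi> \<phi>)}"
    then obtain g h where gh: "(g, h) \<in> adj_graph D (E_op \<psi> \<phi>)" and p: "p = (g, \<lambda>z. - \<i> * h z)"
      by (auto simp: m_def fun_eq_iff)
    have "fock_inner f (\<lambda>z. - \<i> * h z) = \<i> * fock_inner f h" for f
      by (subst fock_inner_scale_right) simp
    moreover have "(\<lambda>z. - \<i> * h z) \<in> fock" using gh by (intro fock_scale) (simp add: adj_graph_def)
    ultimately show "p \<in> adj_graph D (E_op (\<lambda>z. \<i> * \<psi> z) \<phi>)"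
      using gh unfolding p adj_graph_def Ei fock_inner_scale_left by simp
  qed
  show ?thesis
    unfolding skew_real_symmetric_op_def real_symmetric_op_def graph adj
    by (rule inj_image_eq_iff[OF \<open>inj m\<close>, symmetric])
qed

text \<open>Multiplying \<open>\<psi>\<close> by \<open>\<i>\<close> keeps the maximal domain,
  \<open>Q\<close> and \<open>q\<close>, and exchanges imaginary with real values of
  \<open>\<theta>\<close>.\<close>

lemma skew_real_symmetric_op_iff:
  fixes \<psi> :: "complex^'n \<Rightarrow> complex"
  assumes \<psi>: "\<psi> \<noteq> (\<lambda>_. 0)" and \<phi>: "holo_self_map \<phi>" and D: "D \<subseteq> dom_max \<psi> \<phi>"
  shows "skew_real_symmetric_op D (E_op \<psi> \<phi>) \<longleftrightarrow> D = dom_max \<psi> \<phi> \<and>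
    (\<exists>Q q \<theta>. cmat_adj Q = Q \<and> Re \<theta> = 0 \<and>
       (\<forall>z. \<psi> z = \<theta> * exp (cinner z q)) \<and> (\<forall>z. \<phi> z = Q *v z + q))"
proof -
  have Ei: "E_op (\<lambda>z. \<i> * \<psi> z) \<phi> f = (\<lambda>z. \<i> * E_op \<psi> \<phi> f z)" for f
    by (simp add: E_op_def mult.assoc)
  have "(\<lambda>z. \<i> * k z) \<in> fock \<longleftrightarrow> k \<in> fock" for k :: "complex^'n \<Rightarrow> complex"
    using fock_scale[of k \<i>] fock_scale[of "\<lambda>z. \<i> * k z" "- \<i>"] by (auto simp: mult.assoc[symmetric])
  then have dom: "dom_max (\<lambda>z. \<i> * \<psi> z) \<phi> = dom_max \<psi> \<phi>"
    by (simp add: dom_max_def Ei)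
  have nz: "(\<lambda>z. \<i> * \<psi> z) \<noteq> (\<lambda>_. 0)" using \<psi> by (auto simp: fun_eq_iff)
  have form: "(\<exists>\<theta>. \<theta> \<in> \<real> \<and> (\<forall>z. \<i> * \<psi> z = \<theta> * exp (cinner z q)))
    \<longleftrightarrow> (\<exists>\<theta>. Re \<theta> = 0 \<and> (\<forall>z. \<psi> z = \<theta> * exp (cinner z q)))" for q
  proof safe
    fix \<theta> assume "\<theta> \<in> \<real>" and *: "\<forall>z. \<i> * \<psi> z = \<theta> * exp (cinner z q)"
    have "\<psi> z = - \<i> * \<theta> * exp (cinner z q)" for z
    proof -
      have "- \<i> * (\<i> * \<psi> z) = - \<i> * (\<theta> * exp (cinner z q))"
        using * by simp
      then show ?thesis by (simp add: mult.assoc)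
    qed
    with \<open>\<theta> \<in> \<real>\<close> show "\<exists>\<theta>. Re \<theta> = 0 \<and> (\<forall>z. \<psi> z = \<theta> * exp (cinner z q))"
      by (intro exI[of _ "- \<i> * \<theta>"]) (auto simp: complex_is_Real_iff)
  next
    fix \<theta> assume "Re \<theta> = 0" "\<forall>z. \<psi> z = \<theta> * exp (cinner z q)"
    then show "\<exists>\<theta>. \<theta> \<in> \<real> \<and> (\<forall>z. \<i> * \<psi> z = \<theta> * exp (cinner z q))"
      by (intro exI[of _ "\<i> * \<theta>"]) (auto simp: complex_is_Real_iff)
  qed
  show ?thesis
    unfolding skew_real_symmetric_op_iff_real
      real_symmetric_op_iff[OF nz \<phi>, unfolded dom, OF D]
    using form by (meson)
qed

theorem theorem1p1:
  fixes \<psi> :: "complex^'n \<Rightarrow> complex" and \<phi> :: "complex^'n \<Rightarrow> complex^'n"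
  assumes "entire_fun \<psi>" and "\<psi> \<noteq> (\<lambda>_. 0)" and "holo_self_map \<phi>"
  shows
   "(real_symmetric_op (dom_max \<psi> \<phi>) (E_op \<psi> \<phi>) \<longleftrightarrow>
      (\<exists>Q q \<theta>. cmat_adj Q = Q \<and> \<theta> \<in> \<real> \<and>
         (\<forall>z. \<psi> z = \<theta> * exp (cinner z q)) \<and> (\<forall>z. \<phi> z = Q *v z + q)))
    \<and> (skew_real_symmetric_op (dom_max \<psi> \<phi>) (E_op \<psi> \<phi>) \<longleftrightarrow>
      (\<exists>Q q \<theta>. cmat_adj Q = Q \<and> Re \<theta> = 0 \<and>
         (\<forall>z. \<psi> z = \<theta> * exp (cinner z q)) \<and> (\<forall>z. \<phi> z = Q *v z + q)))
    \<and> (\<forall>D. D \<subseteq> dom_max \<psi> \<phi> \<longrightarrow>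
        (real_symmetric_op D (E_op \<psi> \<phi>) \<longleftrightarrow>
          D = dom_max \<psi> \<phi> \<and>
          (\<exists>Q q \<theta>. cmat_adj Q = Q \<and> \<theta> \<in> \<real> \<and>
             (\<forall>z. \<psi> z = \<theta> * exp (cinner z q)) \<and> (\<forall>z. \<phi> z = Q *v z + q))))
    \<and> (\<forall>D. D \<subseteq> dom_max \<psi> \<phi> \<longrightarrow>
        (skew_real_symmetric_op D (E_op \<psi> \<phi>) \<longleftrightarrow>
          D = dom_max \<psi> \<phi> \<and>
          (\<exists>Q q \<theta>. cmat_adj Q = Q \<and> Re \<theta> = 0 \<and>
             (\<forall>z. \<psi> z = \<theta> * exp (cinner z q)) \<and> (\<forall>z. \<phi> z = Q *v z + q))))"
  using real_symmetric_op_iff[OF assms(2,3)] skew_real_symmetric_op_iff[OF assms(2,3)]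
  by simp

end
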